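(* For the split $\imath$quantum group $\mathbf U^\imath=\mathbf U^\imath(\mathfrak{sl}_{n+1})$, with $N=n(n+1)/2$, the Lyndon basis $\mathbf B_{\mathcal L}$ and the PBW-type basis $\mathbf B_{\mathrm{PBW}}$ coincide, where $$\mathbf B_{\mathcal L}=\{B_{[l_1][l_2]\cdots[l_m]}\mid l_1,\dots,l_m\in\mathcal{GL}(\mathbf U^\imath),\ l_1\ge\cdots\ge l_m\},$$ $$\mathbf B_{\mathrm{PBW}}=\{B_{\beta_1}^{a_1}B_{\beta_2}^{a_2}\cdots B_{\beta_N}^{a_N}\mid a_1,\dots,a_N\in\mathbb Z_{\ge0}\}.$$
   Context: Algebra. Let $\mathfrak g=\mathfrak{sl}_{n+1}$ with simple roots $\alpha_1,\dots,\alpha_n$ numbered in the standard way along the Dynkin diagram, $(\alpha_i,\alpha_i)=2$, $(\alpha_i,\alpha_{i\pm1})=-1$, all other $(\alpha_i,\alpha_j)=0$; $s_i$ are the simple reflections of the Weyl group. Let $q\in\mathbb C$ be not a root of unity. $U_q(\mathfrak{sl}_{n+1})$ is the usual quantum group over $\mathbb Q(q)$ with generators $E_i,F_i,K_i^{\pm1}$, where the $K_i^{\pm1}$ commute, $K_iE_jK_i^{-1}=q^{(\alpha_i,\alpha_j)}E_j$, $K_iF_jK_i^{-1}=q^{-(\alpha_i,\alpha_j)}F_j$, $E_iF_j-F_jE_i=\delta_{ij}\frac{K_i-K_i^{-1}}{q-q^{-1}}$, and the quantum Serre relations hold. $\mathbf U^\imath$ is the $\mathbb Q(q)$-subalgebra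 generated by $B_i=F_i+\xi_iE_iK_i^{-1}$ ($1\le i\le n$) with $\xi_i=-q^{-2}$. Words. Let $T(V)$ be the free associative $\mathbb Q(q)$-algebra (tensor algebra) on letters $v_1,\dots,v_n$. For a word $w=v_{i_1}\cdots v_{i_k}$ put $\ell(w)=k$, $|w|=\alpha_{i_1}+\cdots+\alpha_{i_k}$, $B_w=B_{i_1}\cdots B_{i_k}$, extended linearly to $T(V)$; the empty product ($m=0$) gives $1$ and is allowed in $\mathbf B_{\mathcal L}$. The order $<$ is lexicographic with $v_1<\cdots<v_n$, a proper prefix being smaller; $x\prec y$ means $\ell(x)<\ell(y)$, or $\ell(x)=\ell(y)$ and $x>y$. A nonempty word is Lyndon if it is a letter or is $<$ each of its proper nonempty suffixes. A nonempty word $g$ is $\mathbf U^\imath$-good if $B_g$ cannot be expressed as a $\mathbb Q(q)$-linear combination of the $B_w$ with $w\prec g$. $\mathcal{GL}(\mathbf U^\imath)$ is the set of $\mathbf U^\imath$-good Lyndon words; it equals $\{v_iv_{i+1}\cdots v_j\mid 1\le i\le j\le n\}$. Bracketing. Put $[x,y]_{q^{-1}}=xy-q^{-(|x|,|y|)}yx$ for words $x,y$, extended bilinearly. For a Lyndon word $l$ put $[l]=l$ if $l$ is a letter; otherwise write $l=l_1l_2$ with $l_1$ the longest proper Lyndon prefix of $l$ (then $l_2$ is Lyndon) and put $[l]=[[l_1],[l_2]]_{q^{-1}}$. Root vectors. Kolb–Pellegrini's algebra automorphisms $\tau_i$ of $\mathbf U^\imath$ are given by $\tau_i(B_j)=B_j$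 if $|i-j|\ne1$ and $\tau_i(B_j)=B_iB_j-qB_jB_i$ if $|i-j|=1$. Fix the reduced expression $w_0=s_1s_2\cdots s_n\,s_1s_2\cdots s_{n-1}\cdots s_1s_2\,s_1=s_{i_1}\cdots s_{i_N}$ of the longest Weyl group element, and put $\beta_j=s_{i_1}\cdots s_{i_{j-1}}(\alpha_{i_j})$ and $B_{\beta_j}=\tau_{i_1}\cdots\tau_{i_{j-1}}(B_{i_j})$ for $1\le j\le N$. The resulting order of the positive roots is $\beta_1=\alpha_1,\ \beta_2=\alpha_1+\alpha_2,\ \dots,\ \beta_n=\alpha_1+\cdots+\alpha_n,\ \beta_{n+1}=\alpha_2,\ \dots,\ \beta_N=\alpha_n$.
   Formalization: As displayed the equality fails for n ≥ 2 (B_2B_1 lies in B_L but not in B_PBW), so one factor order is reversed: B_L equals the products B_{β_N}^{a_N}⋯B_{β_1}^{a_1}, and B_PBW equals the Lyndon products with l_1 ≤ ⋯ ≤ l_m. *)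

theory Defs
  imports Complex_Main "HOL-Library.Poly_Mapping" "HOL-Library.List_Lexorder"
    "HOL-Algebra.QuotRing" "HOL-Algebra.Generated_Fields" "HOL-Algebra.Algebraic_Closure_Type"
begin

section \<open>Free algebras\<close>

text \<open>
  Words are lists; \<open>+\<close> on words is concatenation, so that the convolution product of
  \<^theory>\<open>HOL-Library.Poly_Mapping\<close> is the product of the free algebra.
\<close>

instantiation list :: (type) monoid_add
begin

definition zero_list :: "'a list" where "zero_list = []"
definition plus_list :: "'a list \<Rightarrow> 'a list \<Rightarrow> 'a list" where "plus_list u v = u @ v"

instance by standard (simp_all add: zero_list_def plus_list_def)

end

type_synonym 'a falg = "'a list \<Rightarrow>\<^sub>0 complex"

abbreviation "supp \<equiv> Poly_Mapping.keys"
abbreviation "coef \<equiv> Poly_Mapping.lookup"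

definition word :: "'a list \<Rightarrow> 'a falg" where
  "word w = Poly_Mapping.single w 1"

definition scal :: "complex \<Rightarrow> 'a falg" where
  "scal c = Poly_Mapping.single [] c"

definition free_algebra :: "complex set \<Rightarrow> 'a set \<Rightarrow> 'a falg ring" where
  "free_algebra k S =
     \<lparr>carrier = {x. (\<forall>w\<in>supp x. set w \<subseteq> S) \<and> (\<forall>w. coef x w \<in> k)},
      monoid.mult = (\<lambda>x y. x * y), one = 1, ring.zero = 0, add = (\<lambda>x y. x + y)\<rparr>"

text \<open>The subfield of the complex numbers generated by \<open>q\<close>.\<close>

definition Qq :: "complex \<Rightarrow> complex set" where
  "Qq q = generate_field ring_of_type_algebra {q}"

section \<open>The root lattice of type A\<close>

definition cartan :: "nat \<Rightarrow> nat \<Rightarrow> int" where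
  "cartan i j = (if i = j then 2 else if i = Suc j \<or> j = Suc i then - 1 else 0)"

definition simple_root :: "nat \<Rightarrow> nat \<Rightarrow>\<^sub>0 int" where
  "simple_root i = Poly_Mapping.single i 1"

definition root_form :: "(nat \<Rightarrow>\<^sub>0 int) \<Rightarrow> (nat \<Rightarrow>\<^sub>0 int) \<Rightarrow> int" where
  "root_form \<beta> \<gamma> =
     (\<Sum>i\<in>supp \<beta>. \<Sum>j\<in>supp \<gamma>. coef \<beta> i * coef \<gamma> j * cartan i j)"

definition weight :: "nat list \<Rightarrow> nat \<Rightarrow>\<^sub>0 int" where
  "weight w = (\<Sum>i\<leftarrow>w. simple_root i)"

section \<open>The quantum group and its split \<open>\<imath>\<close>-subalgebra\<close>

datatype qgen = GE nat | GF nat | GK nat | GKinv nat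

definition qgens :: "nat \<Rightarrow> qgen set" where
  "qgens n = (\<Union>i\<in>{1..n}. {GE i, GF i, GK i, GKinv i})"

abbreviation "EE i \<equiv> word [GE i]"
abbreviation "FF i \<equiv> word [GF i]"
abbreviation "KK i \<equiv> word [GK i]"
abbreviation "KKinv i \<equiv> word [GKinv i]"

text \<open>Elements of the free algebra that are set to zero.\<close>

definition serre_relator :: "complex \<Rightarrow> (nat \<Rightarrow> qgen falg) \<Rightarrow> nat \<Rightarrow> nat \<Rightarrow> qgen falg" where
  "serre_relator q S i j =
     (if cartan i j = - 1
      then S i * S i * S j - scal (q + inverse q) * S i * S j * S i + S j * S i * S i
      else S i * S j - S j * S i)"

definition Uq_relators :: "complex \<Rightarrow> nat \<Rightarrow> qgen falg set" where
  "Uq_relators q n =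
     (\<Union>i\<in>{1..n}. {KK i * KKinv i - 1, KKinv i * KK i - 1}) \<union>
     (\<Union>i\<in>{1..n}. \<Union>j\<in>{1..n}.
        {KK i * KK j - KK j * KK i,
         KK i * EE j * KKinv i - scal (q powi cartan i j) * EE j,
         KK i * FF j * KKinv i - scal (q powi (- cartan i j)) * FF j,
         EE i * FF j - FF j * EE i
           - (if i = j then scal (1 / (q - inverse q)) * (KK i - KKinv i) else 0)}) \<union>
     (\<Union>i\<in>{1..n}. \<Union>j\<in>{1..n} - {i}. {serre_relator q EE i j, serre_relator q FF i j})"

abbreviation Uq_free :: "complex \<Rightarrow> nat \<Rightarrow> qgen falg ring" where
  "Uq_free q n \<equiv> free_algebra (Qq q) (qgens n)"

definition Uq_ideal :: "complex \<Rightarrow> nat \<Rightarrow> qgen falg set" where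
  "Uq_ideal q n = Idl\<^bsub>Uq_free q n\<^esub> (Uq_relators q n)"

definition Uq :: "complex \<Rightarrow> nat \<Rightarrow> qgen falg set ring" where
  "Uq q n = Uq_free q n Quot Uq_ideal q n"

definition Uq_class :: "complex \<Rightarrow> nat \<Rightarrow> qgen falg \<Rightarrow> qgen falg set" where
  "Uq_class q n x = Uq_ideal q n +>\<^bsub>Uq_free q n\<^esub> x"

definition Uscal :: "complex \<Rightarrow> nat \<Rightarrow> complex \<Rightarrow> qgen falg set" where
  "Uscal q n c = Uq_class q n (scal c)"

definition Bgen :: "complex \<Rightarrow> nat \<Rightarrow> nat \<Rightarrow> qgen falg set" where
  "Bgen q n i = Uq_class q n (FF i + scal (- (q powi (- 2))) * EE i * KKinv i)"

definition Ui :: "complex \<Rightarrow> nat \<Rightarrow> qgen falg set ring" where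
  "Ui q n = (Uq q n)\<lparr>carrier := generate_ring (Uq q n) (Uscal q n ` Qq q \<union> Bgen q n ` {1..n})\<rparr>"

definition ordered_prod :: "('a, 'b) monoid_scheme \<Rightarrow> 'a list \<Rightarrow> 'a" where
  "ordered_prod R xs = foldr (\<lambda>x y. x \<otimes>\<^bsub>R\<^esub> y) xs \<one>\<^bsub>R\<^esub>"

section \<open>Good Lyndon words and bracketing\<close>

text \<open>
  The letter \<open>v\<^sub>i\<close> is the natural number \<open>i\<close>. The order \<open><\<close> on words is the one
  of \<^theory>\<open>HOL-Library.List_Lexorder\<close>, in which a proper prefix is smaller.
\<close>

abbreviation TV :: "complex \<Rightarrow> nat \<Rightarrow> nat falg ring" where
  "TV q n \<equiv> free_algebra (Qq q) {1..n}"

definition Bword :: "complex \<Rightarrow> nat \<Rightarrow> nat list \<Rightarrow> qgen falg set" where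
  "Bword q n w = ordered_prod (Ui q n) (map (Bgen q n) w)"

definition Blin :: "complex \<Rightarrow> nat \<Rightarrow> nat falg \<Rightarrow> qgen falg set" where
  "Blin q n x =
     (\<Oplus>\<^bsub>Ui q n\<^esub>w\<in>supp x. Uscal q n (coef x w) \<otimes>\<^bsub>Ui q n\<^esub> Bword q n w)"

definition word_prec :: "nat list \<Rightarrow> nat list \<Rightarrow> bool" (infix \<open>\<prec>\<^sub>w\<close> 50) where
  "x \<prec>\<^sub>w y \<longleftrightarrow> length x < length y \<or> (length x = length y \<and> x > y)"

definition lyndon :: "nat list \<Rightarrow> bool" where
  "lyndon w \<longleftrightarrow> w \<noteq> [] \<and>
     (length w = 1 \<or> (\<forall>u v. w = u @ v \<and> u \<noteq> [] \<and> v \<noteq> [] \<longrightarrow> w < v))"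

text \<open>
  A linear combination of the \<open>B\<^sub>w\<close> with \<open>w \<prec> g\<close> is the image of an element of
  \<open>T(V)\<close> supported on such words.
\<close>

definition Ui_good :: "complex \<Rightarrow> nat \<Rightarrow> nat list \<Rightarrow> bool" where
  "Ui_good q n g \<longleftrightarrow> g \<noteq> [] \<and> set g \<subseteq> {1..n} \<and>
     \<not> (\<exists>x\<in>carrier (TV q n). (\<forall>w\<in>supp x. w \<prec>\<^sub>w g) \<and> Bword q n g = Blin q n x)"

definition good_lyndon :: "complex \<Rightarrow> nat \<Rightarrow> nat list set" where
  "good_lyndon q n = {l. lyndon l \<and> Ui_good q n l}"

definition qbracket :: "complex \<Rightarrow> nat falg \<Rightarrow> nat falg \<Rightarrow> nat falg" where
  "qbracket q x y = (\<Sum>u\<in>supp x. \<Sum>v\<in>supp y. scal (coef x u * coef y v) *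
     (word u * word v - scal (q powi (- root_form (weight u) (weight v))) * word v * word u))"

definition lyndon_split :: "nat list \<Rightarrow> nat" where
  "lyndon_split l = Max {k. 0 < k \<and> k < length l \<and> lyndon (take k l)}"

lemma lyndon_split_bounds:
  assumes "1 < length l"
  shows "0 < lyndon_split l" "lyndon_split l < length l"
proof -
  let ?S = "{k. 0 < k \<and> k < length l \<and> lyndon (take k l)}"
  have "1 \<in> ?S" using assms by (auto simp: lyndon_def)
  then have "Max ?S \<in> ?S" by (intro Max_in) auto
  then show "0 < lyndon_split l" "lyndon_split l < length l"
    by (auto simp: lyndon_split_def)
qed

text \<open>The recursion makes sense for every word; it is only used for Lyndon words.\<close>

function bracketing :: "complex \<Rightarrow> nat list \<Rightarrow> nat falg" where
  "bracketing q l =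
     (if length l \<le> 1 then word l
      else qbracket q (bracketing q (take (lyndon_split l) l))
                      (bracketing q (drop (lyndon_split l) l)))"
  by pat_completeness auto
termination
  by (relation "Wellfounded.measure (\<lambda>(q, l). length l)")
     (use lyndon_split_bounds in \<open>fastforce simp: not_le\<close>)+

declare bracketing.simps [simp del]

section \<open>The two bases\<close>

definition lyndon_basis :: "complex \<Rightarrow> nat \<Rightarrow> qgen falg set set" where
  "lyndon_basis q n =
     {Blin q n (prod_list (map (bracketing q) ls)) | ls.
        set ls \<subseteq> good_lyndon q n \<and> sorted_wrt (\<ge>) ls}"

definition braid_automorphisms ::
    "complex \<Rightarrow> nat \<Rightarrow> (nat \<Rightarrow> qgen falg set \<Rightarrow> qgen falg set) \<Rightarrow> bool" where
  "braid_automorphisms q n \<tau> \<longleftrightarrow>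
     (\<forall>i\<in>{1..n}. \<tau> i \<in> ring_iso (Ui q n) (Ui q n) \<and>
        (\<forall>c\<in>Qq q. \<tau> i (Uscal q n c) = Uscal q n c) \<and>
        (\<forall>j\<in>{1..n}. \<tau> i (Bgen q n j) =
           (if i = Suc j \<or> j = Suc i
            then Bgen q n i \<otimes>\<^bsub>Ui q n\<^esub> Bgen q n j
                   \<ominus>\<^bsub>Ui q n\<^esub> Uscal q n q \<otimes>\<^bsub>Ui q n\<^esub> Bgen q n j \<otimes>\<^bsub>Ui q n\<^esub> Bgen q n i
            else Bgen q n j)))"

text \<open>The indices of \<open>s\<^sub>1\<dots>s\<^sub>n s\<^sub>1\<dots>s\<^sub>n\<^sub>-\<^sub>1 \<dots> s\<^sub>1s\<^sub>2 s\<^sub>1\<close>.\<close>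

definition longest_word :: "nat \<Rightarrow> nat list" where
  "longest_word n = concat (map (\<lambda>m. [1..<Suc m]) (rev [1..<Suc n]))"

text \<open>The root vector \<open>B\<^bsub>\<beta>\<^sub>j\<^esub>\<close>, for \<open>1 \<le> j \<le> N\<close>.\<close>

definition root_vector ::
    "complex \<Rightarrow> nat \<Rightarrow> (nat \<Rightarrow> qgen falg set \<Rightarrow> qgen falg set) \<Rightarrow> nat \<Rightarrow> qgen falg set" where
  "root_vector q n \<tau> j =
     foldr \<tau> (take (j - 1) (longest_word n)) (Bgen q n (longest_word n ! (j - 1)))"

definition num_pos_roots :: "nat \<Rightarrow> nat" where
  "num_pos_roots n = n * (n + 1) div 2"

definition pbw_basis ::
    "complex \<Rightarrow> nat \<Rightarrow> (nat \<Rightarrow> qgen falg set \<Rightarrow> qgen falg set) \<Rightarrow> qgen falg set set" where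
  "pbw_basis q n \<tau> =
     {ordered_prod (Ui q n)
        (map (\<lambda>j. root_vector q n \<tau> j [^]\<^bsub>Ui q n\<^esub> (a j)) [1..<Suc (num_pos_roots n)])
      | a :: nat \<Rightarrow> nat. True}"

text \<open>
  The same two families with the factors multiplied in the opposite order. They are needed
  because the factors of \<^const>\<open>lyndon_basis\<close> decrease lexicographically from left to
  right, whereas along \<open>\<beta>\<^sub>1, \<dots>, \<beta>\<^sub>N\<close> the corresponding Lyndon words
  \<open>v\<^sub>1 < v\<^sub>1v\<^sub>2 < \<dots> < v\<^sub>n\<close> increase.
\<close>

definition lyndon_basis_opp :: "complex \<Rightarrow> nat \<Rightarrow> qgen falg set set" where
  "lyndon_basis_opp q n =
     {Blin q n (prod_list (map (bracketing q) ls)) | ls.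
        set ls \<subseteq> good_lyndon q n \<and> sorted_wrt (\<le>) ls}"

definition pbw_basis_opp ::
    "complex \<Rightarrow> nat \<Rightarrow> (nat \<Rightarrow> qgen falg set \<Rightarrow> qgen falg set) \<Rightarrow> qgen falg set set" where
  "pbw_basis_opp q n \<tau> =
     {ordered_prod (Ui q n)
        (map (\<lambda>j. root_vector q n \<tau> j [^]\<^bsub>Ui q n\<^esub> (a j)) (rev [1..<Suc (num_pos_roots n)]))
      | a :: nat \<Rightarrow> nat. True}"

end

theory Submission
  imports Defs
begin

text \<open>
  Both families consist of the ordered monomials in one list of elements of \<open>\<^bold>U\<^sup>\<imath>\<close>, taken in the same
  order. The proof therefore has two parts: the good Lyndon words are the intervals
  \<open>v\<^sub>iv\<^sub>i\<^sub>+\<^sub>1 \<cdots> v\<^sub>j\<close>, and the \<open>k\<close>-th root vector is the bracketing of the \<open>k\<close>-th interval.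

  The bracketing of an interval satisfies \<open>[v\<^sub>i \<cdots> v\<^sub>j] = [v\<^sub>i \<cdots> v\<^sub>j\<^sub>-\<^sub>1] v\<^sub>j - q v\<^sub>j [v\<^sub>i \<cdots> v\<^sub>j\<^sub>-\<^sub>1]\<close>, which is
  also the recursion of \<open>\<tau>\<^sub>i \<cdots> \<tau>\<^sub>j\<^sub>-\<^sub>1(B\<^sub>j)\<close> (\<open>bracketing_ival\<close>, \<open>foldr_sig_br\<close>). The first block of
  \<open>w\<^sub>0\<close> yields in this way the intervals that start at one. The other blocks yield the remaining ones,
  because \<open>\<tau>\<^sub>1 \<cdots> \<tau>\<^sub>m\<close> maps \<open>B\<^sub>i\<close> to \<open>B\<^sub>i\<^sub>+\<^sub>1\<close> for \<open>i < m\<close>; this comes down to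
  \<open>\<tau>\<^sub>i\<tau>\<^sub>i\<^sub>+\<^sub>1(B\<^sub>i) = B\<^sub>i\<^sub>+\<^sub>1\<close>, which is the inhomogeneous Serre relation
  \<open>B\<^sub>i\<^sup>2B\<^sub>j - (q + q\<inverse>) B\<^sub>iB\<^sub>jB\<^sub>i + B\<^sub>jB\<^sub>i\<^sup>2 = - q\<inverse> B\<^sub>j\<close> (\<open>b_serre\<close>, \<open>sig_sig_letter\<close>,
  \<open>roots_longest_word\<close>).

  Intervals are good by a look at the vector representation, in which every \<open>B\<^sub>i\<close> moves a basis vector
  by one step: the word \<open>v\<^sub>i \<cdots> v\<^sub>j\<close> is the only one of length at most \<open>j - i + 1\<close> that leads from the
  basis vector \<open>j + 1\<close> to the basis vector \<open>i\<close> (\<open>ival_good\<close>). For the converse, every nonempty factor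
  of a good word is good, and three kinds of words are not good: \<open>v\<^sub>iv\<^sub>j\<close> with \<open>j \<ge> i + 2\<close>; an interval
  of length at least two followed by its second letter; an interval followed by the one that is
  longer by a letter at the end. The last two come from relations in two letters, transported by the
  automorphisms \<open>\<tau>\<close> to relations between the bracketing of an interval and a letter; their leading
  words are then read off, as the leading word of a bracketing is the interval itself (\<open>br_leading\<close>,
  \<open>not_good_ival_second\<close>, \<open>not_good_ival_ival\<close>). A Lyndon word without such factors is an interval
  (\<open>lyndon_power_contradiction\<close>).

  The computations take place in free algebras, modulo the ideal of the relations. The automorphisms
  \<open>\<tau>\<^sub>i\<close> are replaced by the substitutions of polynomials for letters which they induce (\<open>tau_Phi\<close>).
\<close>

section \<open>Linear combinations of words\<close>

lemma Qq_closed [simp, intro]: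
  shows Qq_gen: "q \<in> Qq q" and Qq_0: "0 \<in> Qq q" and Qq_1: "1 \<in> Qq q"
    and Qq_uminus: "a \<in> Qq q \<Longrightarrow> - a \<in> Qq q"
    and Qq_inverse: "a \<in> Qq q \<Longrightarrow> inverse a \<in> Qq q"
    and Qq_add: "a \<in> Qq q \<Longrightarrow> b \<in> Qq q \<Longrightarrow> a + b \<in> Qq q"
    and Qq_diff: "a \<in> Qq q \<Longrightarrow> b \<in> Qq q \<Longrightarrow> a - b \<in> Qq q"
    and Qq_mult: "a \<in> Qq q \<Longrightarrow> b \<in> Qq q \<Longrightarrow> a * b \<in> Qq q"
    and Qq_divide: "a \<in> Qq q \<Longrightarrow> b \<in> Qq q \<Longrightarrow> a / b \<in> Qq q"
    and Qq_power: "a \<in> Qq q \<Longrightarrow> a ^ m \<in> Qq q"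
    and Qq_powi: "a \<in> Qq q \<Longrightarrow> a powi z \<in> Qq q"
proof -
  let ?R = "ring_of_type_algebra :: complex ring"
  interpret K: Ring.field ?R by (rule field_from_type_algebra)
  have sub: "subfield (Qq q) ?R"
    unfolding Qq_def by (rule K.generate_field_is_subfield) (simp add: ring_of_type_algebra_def)
  have R: "carrier ?R = UNIV" "\<And>x y. x \<oplus>\<^bsub>?R\<^esub> y = x + y" "\<And>x y. x \<otimes>\<^bsub>?R\<^esub> y = x * y"
      "\<zero>\<^bsub>?R\<^esub> = 0" "\<one>\<^bsub>?R\<^esub> = 1"
    by (simp_all add: ring_of_type_algebra_def)
  have neg: "\<ominus>\<^bsub>?R\<^esub> x = - x" for x
    by (rule K.minus_equality) (simp_all add: R)
  have inv: "inv\<^bsub>?R\<^esub> x = inverse x" if "x \<noteq> 0" for x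
    by (rule K.inv_char) (use that in \<open>simp_all add: R\<close>)
  note S = subringE[OF subfieldE(1)[OF sub], unfolded R neg]
  show gen: "q \<in> Qq q" by (simp add: Qq_def generate_field.incl)
  show "0 \<in> Qq q" "1 \<in> Qq q" using S by auto
  show um: "- a \<in> Qq q" if "a \<in> Qq q" for a using S that by auto
  show ad: "a + b \<in> Qq q" if "a \<in> Qq q" "b \<in> Qq q" for a b using S that by auto
  show mu: "a * b \<in> Qq q" if "a \<in> Qq q" "b \<in> Qq q" for a b using S that by auto
  show iv: "inverse a \<in> Qq q" if "a \<in> Qq q" for a
    using generate_field.m_inv[of a ?R "{q}"] that S inv
    by (cases "a = 0") (auto simp: Qq_def R)
  show "a - b \<in> Qq q" if "a \<in> Qq q" "b \<in> Qq q" for a b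
    using ad[OF that(1) um[OF that(2)]] by simp
  show "a / b \<in> Qq q" if "a \<in> Qq q" "b \<in> Qq q" for a b
    using mu[OF that(1) iv[OF that(2)]] by (simp add: divide_inverse)
  show pw: "a ^ m \<in> Qq q" if "a \<in> Qq q" for a m
    by (induction m) (use S mu that in auto)
  show "a powi z \<in> Qq q" if "a \<in> Qq q" for a z
    using pw that iv by (auto simp: power_int_def)
qed

definition smul :: "complex \<Rightarrow> 'a falg \<Rightarrow> 'a falg" (infixr \<open>\<cdot>\<close> 75) where
  "c \<cdot> x = scal c * x"

lemma single_mult_single:
  "Poly_Mapping.single u c * Poly_Mapping.single v d = Poly_Mapping.single (u @ v) (c * d)"
  for c d :: complex
  by (simp add: mult_single plus_list_def)

lemma falg_induct [case_names zero single add]: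
  fixes x :: "'a falg"
  assumes "P 0" and "\<And>w c. P (Poly_Mapping.single w c)"
    and "\<And>x y. P x \<Longrightarrow> P y \<Longrightarrow> P (x + y)"
  shows "P x"
proof (induction x rule: update_induct)
  case (update f a b)
  have "Poly_Mapping.update a b f = Poly_Mapping.single a b + f"
    using update.hyps
    by (intro poly_mapping_eqI) (auto simp: lookup_update lookup_add lookup_single in_keys_iff)
  then show ?case using assms(2,3) update.IH by simp
qed (rule assms(1))

lemma scal_central: "scal c * x = x * scal c"
  by (induction x rule: falg_induct)
    (simp_all add: scal_def single_mult_single algebra_simps)

lemma scal_mult_scal: "scal c * scal d = scal (c * d)"
  by (simp add: scal_def single_mult_single)

lemma scal_simps [simp]: "scal 0 = 0" "scal 1 = 1"
  by (simp_all add: scal_def flip: single_one) (simp add: zero_list_def)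

lemma scal_add: "scal (c + d) = scal c + scal d"
  and scal_diff: "scal (c - d) = scal c - scal d"
  and scal_uminus: "scal (- c) = - scal c"
  by (simp_all add: scal_def single_add single_diff single_uminus)

lemma scal_conv_smul: "scal c = c \<cdot> 1"
  by (simp add: smul_def)

lemma smul_simps:
  shows smul_smul: "c \<cdot> d \<cdot> x = (c * d) \<cdot> x"
    and smul_mult_left: "(c \<cdot> x) * y = c \<cdot> (x * y)"
    and smul_mult_right: "x * (c \<cdot> y) = c \<cdot> (x * y)"
    and smul_add: "c \<cdot> (x + y) = c \<cdot> x + c \<cdot> y"
    and smul_diff: "c \<cdot> (x - y) = c \<cdot> x - c \<cdot> y"
    and smul_minus: "c \<cdot> (- x) = - (c \<cdot> x)"
    and smul_left_add: "(c + d) \<cdot> x = c \<cdot> x + d \<cdot> x"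
    and smul_left_diff: "(c - d) \<cdot> x = c \<cdot> x - d \<cdot> x"
    and smul_left_minus: "(- c) \<cdot> x = - (c \<cdot> x)"
    and smul_0 [simp]: "0 \<cdot> x = 0"
    and smul_1 [simp]: "1 \<cdot> x = x"
    and smul_zero [simp]: "c \<cdot> 0 = 0"
proof -
  show "x * (c \<cdot> y) = c \<cdot> (x * y)"
    unfolding smul_def by (simp add: scal_central[of c x] flip: mult.assoc)
qed (simp_all add: smul_def scal_add scal_diff scal_uminus algebra_simps flip: scal_mult_scal)

lemma smul_sum: "c \<cdot> sum f A = (\<Sum>a\<in>A. c \<cdot> f a)"
  by (simp add: smul_def sum_distrib_left)

lemma single_conv_smul: "Poly_Mapping.single w c = c \<cdot> word w"
  by (simp add: smul_def scal_def word_def single_mult_single)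

lemma word_mult: "word u * word v = word (u @ v)"
  by (simp add: word_def single_mult_single)

lemma word_Nil [simp]: "word [] = 1"
  by (simp add: word_def zero_list_def flip: single_one)

lemma supp_multE:
  fixes x y :: "'a falg"
  assumes "w \<in> supp (x * y)"
  obtains u v where "u \<in> supp x" "v \<in> supp y" "w = u @ v"
  using keys_mult[of x y] assms by (auto simp: plus_list_def)

lemma supp_smul: "supp (c \<cdot> x) \<subseteq> supp x"
proof
  fix w assume "w \<in> supp (c \<cdot> x)"
  then show "w \<in> supp x"
    unfolding smul_def scal_def by (auto elim!: supp_multE split: if_splits)
qed

lemma supp_uminus [simp]: "supp (- x) = supp x" for x :: "'a falg"
  by (auto simp: in_keys_iff)

lemma supp_add: "supp (x + y) \<subseteq> supp x \<union> supp y" for x y :: "'a falg"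
  by (rule keys_add)

lemma supp_diff: "supp (x - y) \<subseteq> supp x \<union> supp y" for x y :: "'a falg"
  using keys_add[of x "- y"] by simp

lemma supp_word [simp]: "supp (word w) = {w}"
  by (simp add: word_def)

lemma coef_word: "coef (word w) v = (if v = w then 1 else 0)"
  by (auto simp: word_def lookup_single)

abbreviation FA :: "complex \<Rightarrow> 'a set \<Rightarrow> 'a falg set" where
  "FA q S \<equiv> carrier (free_algebra (Qq q) S)"

lemma FA_iff: "x \<in> FA q S \<longleftrightarrow> (\<forall>w\<in>supp x. set w \<subseteq> S) \<and> (\<forall>w. coef x w \<in> Qq q)"
  by (simp add: free_algebra_def)

lemma free_algebra_simps [simp]:
  "x \<otimes>\<^bsub>free_algebra k S\<^esub> y = x * y" "x \<oplus>\<^bsub>free_algebra k S\<^esub> y = x + y"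
  "\<one>\<^bsub>free_algebra k S\<^esub> = 1" "\<zero>\<^bsub>free_algebra k S\<^esub> = 0"
  by (simp_all add: free_algebra_def)

lemma FA_0 [simp, intro]: "0 \<in> FA q S"
  by (simp add: FA_iff)

lemma FA_single: "c \<in> Qq q \<Longrightarrow> set w \<subseteq> S \<Longrightarrow> Poly_Mapping.single w c \<in> FA q S"
  by (auto simp: FA_iff lookup_single when_def)

lemma FA_word [simp, intro]: "set w \<subseteq> S \<Longrightarrow> word w \<in> FA q S"
  by (simp add: FA_single word_def)

lemma FA_scal [simp, intro]: "c \<in> Qq q \<Longrightarrow> scal c \<in> FA q S"
  by (simp add: FA_single scal_def)

lemma FA_1 [simp, intro]: "1 \<in> FA q S"
  using FA_scal[of 1 q S] by simp

lemma FA_add [simp, intro]: "x \<in> FA q S \<Longrightarrow> y \<in> FA q S \<Longrightarrow> x + y \<in> FA q S"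
  using supp_add[of x y] by (simp add: FA_iff lookup_add subset_iff) blast

lemma FA_uminus [simp, intro]: "x \<in> FA q S \<Longrightarrow> - x \<in> FA q S"
  by (auto simp: FA_iff)

lemma FA_diff [simp, intro]: "x \<in> FA q S \<Longrightarrow> y \<in> FA q S \<Longrightarrow> x - y \<in> FA q S"
  using FA_add[of x q S "- y"] by simp

lemma FA_sum: "(\<And>a. a \<in> A \<Longrightarrow> f a \<in> FA q S) \<Longrightarrow> sum f A \<in> FA q S"
  by (induction A rule: infinite_finite_induct) auto

lemma FA_induct [consumes 1, case_names zero single add]:
  assumes "x \<in> FA q S" "P 0"
    and "\<And>w c. set w \<subseteq> S \<Longrightarrow> c \<in> Qq q \<Longrightarrow> P (Poly_Mapping.single w c)"
    and "\<And>x y. x \<in> FA q S \<Longrightarrow> y \<in> FA q S \<Longrightarrow> P x \<Longrightarrow> P y \<Longrightarrow> P (x + y)"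
  shows "P x"
  using assms(1)
proof (induction x rule: update_induct)
  case (update f a b)
  have eq: "Poly_Mapping.update a b f = Poly_Mapping.single a b + f"
    using update.hyps
    by (intro poly_mapping_eqI) (auto simp: lookup_update lookup_add lookup_single in_keys_iff)
  have fa: "coef f a = 0"
    using update.hyps by (simp add: in_keys_iff)
  have c: "coef f w \<in> Qq q" for w
    using update.prems fa by (cases "w = a") (auto simp: FA_iff lookup_update split: if_splits)
  have b: "b \<in> Qq q" "set a \<subseteq> S"
    using update.prems update.hyps by (auto simp: FA_iff lookup_update keys_update split: if_splits)
  have f: "f \<in> FA q S"
    using update.prems c update.hyps by (auto simp: FA_iff keys_update split: if_splits)
  show ?case unfolding eq
    by (rule assms(4)) (use b f update.IH assms(3) in \<open>auto intro: FA_single\<close>)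
qed (rule assms(2))

lemma FA_mult [simp, intro]:
  assumes "x \<in> FA q S" "y \<in> FA q S" shows "x * y \<in> FA q S"
  using assms(1)
proof (induction rule: FA_induct)
  case (single u c)
  from assms(2) show ?case
    by (induction rule: FA_induct)
      (use single in \<open>auto simp: single_mult_single ring_distribs intro!: FA_single\<close>)
qed (auto simp: algebra_simps)

lemma FA_smul [simp, intro]: "c \<in> Qq q \<Longrightarrow> x \<in> FA q S \<Longrightarrow> c \<cdot> x \<in> FA q S"
  by (simp add: smul_def)

lemma FA_power [simp, intro]: "x \<in> FA q S \<Longrightarrow> x ^ m \<in> FA q S"
  by (induction m) auto

lemma FA_prod_list: "set xs \<subseteq> FA q S \<Longrightarrow> prod_list xs \<in> FA q S"
  by (induction xs) auto

lemma ring_free_algebra: "ring (free_algebra (Qq q) S)"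
proof (rule ringI)
  show "abelian_group (free_algebra (Qq q) S)"
    by (rule abelian_groupI) (auto simp: algebra_simps intro: bexI[of _ "- _"])
  show "Group.monoid (free_algebra (Qq q) S)"
    by (rule Group.monoid.intro) (auto simp: algebra_simps)
qed (auto simp: algebra_simps)

lemma free_algebra_a_inv:
  assumes "x \<in> FA q S" shows "\<ominus>\<^bsub>free_algebra (Qq q) S\<^esub> x = - x"
proof -
  interpret ring "free_algebra (Qq q) S" by (rule ring_free_algebra)
  show ?thesis by (rule minus_equality) (use assms in auto)
qed

section \<open>Substitution\<close>

definition subst :: "('a \<Rightarrow> 'b falg) \<Rightarrow> 'a falg \<Rightarrow> 'b falg" where
  "subst b x = (\<Sum>w\<in>supp x. coef x w \<cdot> prod_list (map b w))"

lemma subst_single: "subst b (Poly_Mapping.single w c) = c \<cdot> prod_list (map b w)"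
  by (simp add: subst_def)

lemma subst_0 [simp]: "subst b 0 = 0"
  by (simp add: subst_def)

lemma subst_add: "subst b (x + y) = subst b x + subst b y"
  unfolding subst_def
  by (rule setsum_keys_plus_distrib[where f = "\<lambda>w c. c \<cdot> prod_list (map b w)"])
    (simp_all add: smul_left_add)

lemma subst_word: "subst b (word w) = prod_list (map b w)"
  by (simp add: word_def subst_single)

lemma subst_scal: "subst b (scal c) = scal c"
  by (simp add: scal_def[of c] subst_single) (simp flip: scal_conv_smul add: scal_def)

lemma subst_1 [simp]: "subst b 1 = 1"
  using subst_scal[of b 1] by simp

lemma subst_mult: "subst b (x * y) = subst b x * subst b y"
proof (induction x rule: falg_induct)
  case (single u c)
  show ?case
    by (induction y rule: falg_induct)
      (simp_all add: single_mult_single subst_single subst_add smul_mult_left smul_mult_right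
        smul_smul ring_distribs mult.commute)
qed (simp_all add: subst_add ring_distribs)

lemma subst_smul: "subst b (c \<cdot> x) = c \<cdot> subst b x"
  by (simp add: smul_def subst_mult subst_scal)

lemma subst_uminus: "subst b (- x) = - subst b x"
  using subst_add[of b x "- x"] by (simp add: eq_neg_iff_add_eq_0 add.commute)

lemma subst_diff: "subst b (x - y) = subst b x - subst b y"
  using subst_add[of b x "- y"] by (simp add: subst_uminus)

lemmas subst_simps = subst_add subst_word subst_mult subst_smul subst_uminus subst_diff

lemma subst_in_FA:
  assumes "\<And>i. i \<in> S \<Longrightarrow> b i \<in> FA q T" and "x \<in> FA q S"
  shows "subst b x \<in> FA q T"
  using assms(2)
proof (induction rule: FA_induct)
  case (single w c)
  then have "prod_list (map b w) \<in> FA q T"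
    using assms(1) by (intro FA_prod_list) auto
  then show ?case using single by (simp add: subst_single)
qed (auto simp: subst_add)

section \<open>Two-sided ideals of a free algebra\<close>

locale falg_ideal =
  fixes q :: complex and S :: "'a set" and I :: "'a falg set"
  assumes is_ideal: "ideal I (free_algebra (Qq q) S)"
begin

lemma I_FA: "x \<in> I \<Longrightarrow> x \<in> FA q S"
proof -
  interpret ideal I "free_algebra (Qq q) S" by (rule is_ideal)
  show "x \<in> I \<Longrightarrow> x \<in> FA q S" by (rule Icarr)
qed

lemma I_closed:
  shows I_0 [simp, intro]: "0 \<in> I"
    and I_add [intro]: "x \<in> I \<Longrightarrow> y \<in> I \<Longrightarrow> x + y \<in> I"
    and I_uminus [intro]: "x \<in> I \<Longrightarrow> - x \<in> I"
    and I_diff [intro]: "x \<in> I \<Longrightarrow> y \<in> I \<Longrightarrow> x - y \<in> I"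
    and I_lmult [intro]: "a \<in> FA q S \<Longrightarrow> x \<in> I \<Longrightarrow> a * x \<in> I"
    and I_rmult [intro]: "a \<in> FA q S \<Longrightarrow> x \<in> I \<Longrightarrow> x * a \<in> I"
    and I_smul [intro]: "c \<in> Qq q \<Longrightarrow> x \<in> I \<Longrightarrow> c \<cdot> x \<in> I"
proof -
  interpret ideal I "free_algebra (Qq q) S" by (rule is_ideal)
  note sub = additive_subgroup_axioms
  have um: "- x \<in> I" if "x \<in> I" for x
    using additive_subgroup.a_inv_closed[OF sub that] I_FA[OF that] by (simp add: free_algebra_a_inv)
  have ad: "x + y \<in> I" if "x \<in> I" "y \<in> I" for x y
    using additive_subgroup.a_closed[OF sub that] by simp
  show "0 \<in> I" using additive_subgroup.zero_closed[OF sub] by simp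
  show "x \<in> I \<Longrightarrow> y \<in> I \<Longrightarrow> x + y \<in> I" by (rule ad)
  show "x \<in> I \<Longrightarrow> - x \<in> I" by (rule um)
  show "x \<in> I \<Longrightarrow> y \<in> I \<Longrightarrow> x - y \<in> I" using ad[of x "- y"] um[of y] by simp
  show lm: "a \<in> FA q S \<Longrightarrow> x \<in> I \<Longrightarrow> a * x \<in> I" for a x using I_l_closed[of x a] by simp
  show "a \<in> FA q S \<Longrightarrow> x \<in> I \<Longrightarrow> x * a \<in> I" using I_r_closed[of x a] by simp
  show "c \<in> Qq q \<Longrightarrow> x \<in> I \<Longrightarrow> c \<cdot> x \<in> I" unfolding smul_def by (rule lm) auto
qed

text \<open>
  Congruence modulo \<open>I\<close>. Membership in the free algebra over \<open>\<rat>(q)\<close> is built in, so that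
  the congruence is compatible with the operations without side conditions.
\<close>

definition eqv :: "'a falg \<Rightarrow> 'a falg \<Rightarrow> bool" (infix \<open>\<approx>\<close> 50) where
  "x \<approx> y \<longleftrightarrow> x \<in> FA q S \<and> y \<in> FA q S \<and> x - y \<in> I"

lemma eqv_refl: "x \<in> FA q S \<Longrightarrow> x \<approx> x"
  by (simp add: eqv_def)

lemma eqv_sym: "x \<approx> y \<Longrightarrow> y \<approx> x"
  using I_uminus[of "x - y"] by (auto simp: eqv_def)

lemma eqv_trans [trans]: "x \<approx> y \<Longrightarrow> y \<approx> z \<Longrightarrow> x \<approx> z"
  using I_add[of "x - y" "y - z"] by (auto simp: eqv_def)

lemma eqv_add: "x \<approx> x' \<Longrightarrow> y \<approx> y' \<Longrightarrow> x + y \<approx> x' + y'"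
  using I_add[of "x - x'" "y - y'"] by (auto simp: eqv_def algebra_simps)

lemma eqv_diff: "x \<approx> x' \<Longrightarrow> y \<approx> y' \<Longrightarrow> x - y \<approx> x' - y'"
  using I_diff[of "x - x'" "y - y'"] by (auto simp: eqv_def algebra_simps)

lemma eqv_mult:
  assumes "x \<approx> x'" "y \<approx> y'" shows "x * y \<approx> x' * y'"
proof -
  have "(x - x') * y + x' * (y - y') \<in> I"
    using assms by (intro I_add I_rmult I_lmult) (auto simp: eqv_def)
  also have "(x - x') * y + x' * (y - y') = x * y - x' * y'"
    by (simp add: algebra_simps)
  finally show ?thesis using assms by (auto simp: eqv_def)
qed

lemma eqv_smul: "c \<in> Qq q \<Longrightarrow> x \<approx> x' \<Longrightarrow> c \<cdot> x \<approx> c \<cdot> x'"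
  using I_smul[of c "x - x'"] by (auto simp: eqv_def smul_diff)

lemmas eqv_intros = eqv_add eqv_diff eqv_mult eqv_smul

end

section \<open>The Serre relation of the generators\<close>

text \<open>
  The quantum Serre expression, linearised in its two equal arguments so that it can be
  expanded trilinearly.
\<close>

definition qserre :: "complex \<Rightarrow> 'a falg \<Rightarrow> 'a falg \<Rightarrow> 'a falg \<Rightarrow> 'a falg" where
  "qserre q a b w = a * b * w - (q + inverse q) \<cdot> (a * w * b) + w * a * b"

lemma qserre_linear:
  "qserre q (x + c \<cdot> y) (x + c \<cdot> y) (u + c \<cdot> v) =
     qserre q x x u + c \<cdot> qserre q x x v + c \<cdot> (qserre q x y u + qserre q y x u)
     + c \<cdot> c \<cdot> (qserre q x y v + qserre q y x v) + c \<cdot> c \<cdot> qserre q y y u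
     + c \<cdot> c \<cdot> c \<cdot> qserre q y y v"
  by (simp add: qserre_def smul_simps algebra_simps)

text \<open>
  For identities in a free algebra with coefficients in \<open>\<int>[q, q\<inverse>]\<close>: a coefficient is spread out
  into a chain of multiplications by \<open>q\<close> and \<open>q\<inverse>\<close>, which cancel, so that both sides of an identity
  reach the same sum of words.
\<close>

lemma smul_unfold: "(a * b) \<cdot> x = a \<cdot> b \<cdot> x"
  by (simp add: smul_smul)

lemma smul_cancel:
  "q \<noteq> 0 \<Longrightarrow> q \<cdot> inverse q \<cdot> x = x" "q \<noteq> 0 \<Longrightarrow> inverse q \<cdot> q \<cdot> x = x"
  by (simp_all add: smul_smul)

lemmas monomial_simps = qserre_def smul_unfold smul_cancel smul_mult_left smul_mult_right smul_add smul_diff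
  smul_minus smul_left_add smul_left_diff smul_left_minus algebra_simps power2_eq_square power3_eq_cube

context falg_ideal
begin

text \<open>
  With \<open>x, y\<close> for \<open>F\<^sub>i, E\<^sub>iK\<^sub>i\<inverse>\<close> and \<open>u, v\<close> for \<open>F\<^sub>j, E\<^sub>jK\<^sub>j\<inverse>\<close>, the conclusion is the relation of
  \<open>B\<^sub>i\<close> and \<open>B\<^sub>j\<close>. The components of the Serre expression of mixed degree vanish except for those of degree \<open>x y u\<close> and \<open>x y v\<close>; these
  produce the inhomogeneous right hand side through \<open>d\<close>, the \<open>q\<close>-commutator of \<open>y\<close> and \<open>x\<close>.
  Each component is written out as a combination of the commutation relators.
\<close>

lemma qserre_inhomogeneous:
  assumes q: "q \<noteq> 0"
    and FA: "x \<in> FA q S" "y \<in> FA q S" "u \<in> FA q S" "v \<in> FA q S" "d \<in> FA q S"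
    and yx: "y * x - q^2 \<cdot> (x * y) - d \<in> I"
    and yu: "y * u - inverse q \<cdot> (u * y) \<in> I"
    and vx: "v * x - inverse q \<cdot> (x * v) \<in> I"
    and du: "d * u - (inverse q)^2 \<cdot> (u * d) - q \<cdot> u \<in> I"
    and dv: "d * v - q^2 \<cdot> (v * d) + q^3 \<cdot> v \<in> I"
    and Su: "qserre q x x u \<in> I" and Sv: "qserre q y y v \<in> I"
    and c: "c = - ((inverse q)^2)"
  shows "qserre q (x + c \<cdot> y) (x + c \<cdot> y) (u + c \<cdot> v) + inverse q \<cdot> (u + c \<cdot> v) \<in> I"
proof -
  define r1 where "r1 = y * x - q^2 \<cdot> (x * y) - d"
  define r2 where "r2 = y * u - inverse q \<cdot> (u * y)"
  define r3 where "r3 = v * x - inverse q \<cdot> (x * v)"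
  define r5 where "r5 = d * u - (inverse q)^2 \<cdot> (u * d) - q \<cdot> u"
  define r6 where "r6 = d * v - q^2 \<cdot> (v * d) + q^3 \<cdot> v"
  note r_defs = r1_def r2_def r3_def r5_def r6_def
  have r: "r1 \<in> I" "r2 \<in> I" "r3 \<in> I" "r5 \<in> I" "r6 \<in> I"
    using yx yu vx du dv by (simp_all add: r_defs)
  note r = r r[THEN I_FA]
  let ?s = "q + inverse q"
  have xxv: "qserre q x x v \<in> I"
  proof -
    have "qserre q x x v = r3 * x + inverse q \<cdot> (x * r3) - ?s \<cdot> (x * r3)"
      using q by (simp add: r_defs monomial_simps)
    also have "\<dots> \<in> I" using FA r by (simp add: I_closed)
    finally show ?thesis .
  qed
  have yyu: "qserre q y y u \<in> I"
  proof -
    have "qserre q y y u = y * r2 + inverse q \<cdot> (r2 * y) - ?s \<cdot> (r2 * y)"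
      using q by (simp add: r_defs monomial_simps)
    also have "\<dots> \<in> I" using FA r by (simp add: I_closed)
    finally show ?thesis .
  qed
  have xyu: "qserre q x y u + qserre q y x u - q \<cdot> u \<in> I"
  proof -
    have "qserre q x y u + qserre q y x u - q \<cdot> u =
        x * r2 + r1 * u + q^2 \<cdot> (x * r2) + r5 - ?s \<cdot> (r2 * x + inverse q \<cdot> (u * r1)) + u * r1"
      using q by (simp add: r_defs monomial_simps)
    also have "\<dots> \<in> I" using FA r by (simp add: I_closed)
    finally show ?thesis .
  qed
  have xyv: "qserre q x y v + qserre q y x v - q \<cdot> v \<in> I"
  proof -
    have "qserre q x y v + qserre q y x v - q \<cdot> v =
        r1 * v - ?s \<cdot> (y * r3 + inverse q \<cdot> (r1 * v)) + r3 * y + v * r1 + q^2 \<cdot> (r3 * y)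
        - (inverse q)^2 \<cdot> r6"
      using q by (simp add: r_defs monomial_simps)
    also have "\<dots> \<in> I" using FA r by (simp add: I_closed)
    finally show ?thesis .
  qed
  have "qserre q (x + c \<cdot> y) (x + c \<cdot> y) (u + c \<cdot> v) + inverse q \<cdot> (u + c \<cdot> v) =
      qserre q x x u + c \<cdot> qserre q x x v + c \<cdot> (qserre q x y u + qserre q y x u - q \<cdot> u)
     + c \<cdot> c \<cdot> (qserre q x y v + qserre q y x v - q \<cdot> v) + c \<cdot> c \<cdot> qserre q y y u
     + c \<cdot> c \<cdot> c \<cdot> qserre q y y v + ((c * q + inverse q) \<cdot> (u + c \<cdot> v))"
    unfolding qserre_linear by (simp add: smul_simps algebra_simps)
  \<comment> \<open>This is where the value of \<open>c\<close> matters: the two inhomogeneous terms add up to \<open>c q (u + c v)\<close>.\<close>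
  also have "c * q + inverse q = 0"
    using q by (simp add: c field_simps power2_eq_square)
  also have "qserre q x x u + c \<cdot> qserre q x x v + c \<cdot> (qserre q x y u + qserre q y x u - q \<cdot> u)
     + c \<cdot> c \<cdot> (qserre q x y v + qserre q y x v - q \<cdot> v) + c \<cdot> c \<cdot> qserre q y y u
     + c \<cdot> c \<cdot> c \<cdot> qserre q y y v + (0 \<cdot> (u + c \<cdot> v)) \<in> I"
    using xxv yyu xyu xyv Su Sv FA
    by (simp only: smul_0 add_0_right) (simp add: I_closed c)
  finally show ?thesis .
qed

text \<open>
  The Serre relation of the \<open>E\<close>'s passes to the \<open>E K\<inverse>\<close>'s: collecting the factors \<open>K\<inverse>\<close> on
  the right gives the same power of \<open>q\<close> for each of the three words.
\<close>

lemma qserre_twist: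
  assumes q: "q \<noteq> 0"
    and FA: "E \<in> FA q S" "G \<in> FA q S" "K \<in> FA q S" "L \<in> FA q S"
    and KE: "K * E - (inverse q)^2 \<cdot> (E * K) \<in> I"
    and KG: "K * G - q \<cdot> (G * K) \<in> I"
    and LE: "L * E - q \<cdot> (E * L) \<in> I"
    and LK: "L * K - K * L \<in> I"
    and SE: "qserre q E E G \<in> I"
  shows "qserre q (E * K) (E * K) (G * L) \<in> I"
proof -
  define r7 where "r7 = K * E - (inverse q)^2 \<cdot> (E * K)"
  define r8 where "r8 = K * G - q \<cdot> (G * K)"
  define r9 where "r9 = L * E - q \<cdot> (E * L)"
  define r10 where "r10 = L * K - K * L"
  note r_defs = r7_def r8_def r9_def r10_def
  have r: "r7 \<in> I" "r8 \<in> I" "r9 \<in> I" "r10 \<in> I"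
    using KE KG LE LK by (simp_all add: r_defs)
  note r = r r[THEN I_FA]
  let ?s = "q + inverse q" and ?p = "inverse q"
  have yyv: "E * K * (E * K) * (G * L) = E * E * G * (K * K * L)
      + (E * r7 * K * G * L + ?p^2 \<cdot> (E * E * (K * r8 + q \<cdot> (r8 * K)) * L))"
    using q by (simp add: r_defs monomial_simps)
  have yvy: "E * K * (G * L) * (E * K) = E * G * E * (K * K * L)
      + (E * r8 * L * E * K + q \<cdot> (E * G * K * r9 * K) + q^2 \<cdot> (E * G * r7 * L * K)
         + E * G * E * K * r10)"
    using q by (simp add: r_defs monomial_simps)
  have vyy: "G * L * (E * K) * (E * K) = G * E * E * (K * K * L)
      + (G * r9 * K * E * K + q \<cdot> (G * E * L * r7 * K) + ?p \<cdot> (G * E * r9 * K * K)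
         + G * E * E * (r10 * K + K * r10))"
    using q by (simp add: r_defs monomial_simps)
  let ?a = "E * r7 * K * G * L + ?p^2 \<cdot> (E * E * (K * r8 + q \<cdot> (r8 * K)) * L)"
  let ?b = "E * r8 * L * E * K + q \<cdot> (E * G * K * r9 * K) + q^2 \<cdot> (E * G * r7 * L * K)
         + E * G * E * K * r10"
  let ?c = "G * r9 * K * E * K + q \<cdot> (G * E * L * r7 * K) + ?p \<cdot> (G * E * r9 * K * K)
         + G * E * E * (r10 * K + K * r10)"
  have abc: "?a \<in> I" "?b \<in> I" "?c \<in> I"
    using FA r by (simp_all add: I_closed)
  have "qserre q (E * K) (E * K) (G * L) = qserre q E E G * (K * K * L) + ?a - ?s \<cdot> ?b + ?c"
    unfolding qserre_def yyv yvy vyy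
    by (simp only: distrib_right left_diff_distrib smul_mult_left smul_add) (simp only: algebra_simps)
  also have "\<dots> \<in> I" using abc SE FA by (simp add: I_closed)
  finally show ?thesis .
qed

end

section \<open>The relations of the generators \<open>B\<^sub>i\<close>\<close>

text \<open>Multiplication by \<open>K\<inverse>\<close> on the left turns the action of \<open>K\<close> by conjugation into that of \<open>K\<inverse>\<close>.\<close>

lemma (in falg_ideal) inverse_commute:
  assumes "K * Z * K' - c \<cdot> Z \<in> I" "K' * K - 1 \<in> I" "c \<noteq> 0" "c \<in> Qq q"
    and FA: "Z \<in> FA q S" "K \<in> FA q S" "K' \<in> FA q S"
  shows "K' * Z - inverse c \<cdot> (Z * K') \<in> I"
proof -
  have "K' * Z - inverse c \<cdot> (Z * K') =
      inverse c \<cdot> ((K' * K - 1) * (Z * K') - K' * (K * Z * K' - c \<cdot> Z))"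
    using \<open>c \<noteq> 0\<close> by (simp add: smul_simps algebra_simps)
  also have "\<dots> \<in> I" using assms by (simp add: I_closed)
  finally show ?thesis .
qed

lemma serre_relator_eq:
  "serre_relator q S i j = (if cartan i j = - 1 then qserre q (S i) (S i) (S j) else S i * S j - S j * S i)"
  by (simp add: serre_relator_def qserre_def smul_def mult.assoc)

locale iquantum =
  fixes q :: complex and n :: nat
  assumes q_nz: "q \<noteq> 0" and q_sq: "q\<^sup>2 \<noteq> 1"
begin

abbreviation "b i \<equiv> FF i + scal (- (q powi (- 2))) * EE i * KKinv i"

lemma b_eq: "b i = FF i + (- ((inverse q)^2)) \<cdot> (EE i * KKinv i)"
  using q_nz by (simp add: smul_def mult.assoc power_int_minus power_inverse)

lemma gens_FA [simp]:
  assumes "i \<in> {1..n}"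
  shows "EE i \<in> FA q (qgens n)" "FF i \<in> FA q (qgens n)"
    "KK i \<in> FA q (qgens n)" "KKinv i \<in> FA q (qgens n)" "b i \<in> FA q (qgens n)"
proof -
  show *: "EE i \<in> FA q (qgens n)" "FF i \<in> FA q (qgens n)"
    "KK i \<in> FA q (qgens n)" "KKinv i \<in> FA q (qgens n)"
    using assms by (auto simp: qgens_def)
  show "b i \<in> FA q (qgens n)" unfolding b_eq using * by simp
qed

lemma relators_FA: "Uq_relators q n \<subseteq> FA q (qgens n)"
proof
  fix r assume "r \<in> Uq_relators q n"
  then show "r \<in> FA q (qgens n)"
    unfolding Uq_relators_def serre_relator_eq
    by (auto simp: qserre_def split: if_splits)
qed

sublocale U: falg_ideal q "qgens n" "Uq_ideal q n"
proof (rule falg_ideal.intro)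
  interpret ring "Uq_free q n" by (rule ring_free_algebra)
  show "ideal (Uq_ideal q n) (Uq_free q n)"
    unfolding Uq_ideal_def by (rule genideal_ideal[OF relators_FA])
qed

lemma relator_in_ideal: "r \<in> Uq_relators q n \<Longrightarrow> r \<in> Uq_ideal q n"
proof -
  interpret ring "Uq_free q n" by (rule ring_free_algebra)
  show "r \<in> Uq_relators q n \<Longrightarrow> r \<in> Uq_ideal q n"
    unfolding Uq_ideal_def using genideal_self[OF relators_FA] by auto
qed

lemma relators:
  assumes ij: "i \<in> {1..n}" "j \<in> {1..n}"
  shows "KK i * KKinv i - 1 \<in> Uq_ideal q n" "KKinv i * KK i - 1 \<in> Uq_ideal q n"
    and "KK i * KK j - KK j * KK i \<in> Uq_ideal q n"
    and "KK i * EE j * KKinv i - q powi cartan i j \<cdot> EE j \<in> Uq_ideal q n"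
    and "KK i * FF j * KKinv i - q powi (- cartan i j) \<cdot> FF j \<in> Uq_ideal q n"
    and "EE i * FF j - FF j * EE i
           - (if i = j then (1 / (q - inverse q)) \<cdot> (KK i - KKinv i) else 0) \<in> Uq_ideal q n"
    and "i \<noteq> j \<Longrightarrow> serre_relator q EE i j \<in> Uq_ideal q n"
    and "i \<noteq> j \<Longrightarrow> serre_relator q FF i j \<in> Uq_ideal q n"
  by (rule relator_in_ideal; use ij in \<open>unfold Uq_relators_def smul_def, blast\<close>)+

lemma Kinv_relations:
  assumes ij: "i \<in> {1..n}" "j \<in> {1..n}"
  shows "KKinv i * EE j - inverse (q powi cartan i j) \<cdot> (EE j * KKinv i) \<in> Uq_ideal q n"
    and "KKinv i * FF j - (q powi cartan i j) \<cdot> (FF j * KKinv i) \<in> Uq_ideal q n"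
    and "KKinv i * KKinv j - KKinv j * KKinv i \<in> Uq_ideal q n"
proof -
  show "KKinv i * EE j - inverse (q powi cartan i j) \<cdot> (EE j * KKinv i) \<in> Uq_ideal q n"
    by (rule U.inverse_commute[of "KK i"]) (use ij relators q_nz in auto)
  have "KKinv i * FF j - inverse (q powi - cartan i j) \<cdot> (FF j * KKinv i) \<in> Uq_ideal q n"
    by (rule U.inverse_commute[of "KK i"]) (use ij relators q_nz in auto)
  then show "KKinv i * FF j - (q powi cartan i j) \<cdot> (FF j * KKinv i) \<in> Uq_ideal q n"
    by (simp add: power_int_minus)
  \<comment> \<open>Commuting elements are the case of the eigenvalue one, so the inverses commute as well.\<close>
  have *: "K * Z * K' - 1 \<cdot> Z \<in> Uq_ideal q n"
    if "K * Z - Z * K \<in> Uq_ideal q n" "K * K' - 1 \<in> Uq_ideal q n"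
      "Z \<in> FA q (qgens n)" "K' \<in> FA q (qgens n)" for K Z K'
  proof -
    have "K * Z * K' - 1 \<cdot> Z = (K * Z - Z * K) * K' + Z * (K * K' - 1)"
      by (simp add: algebra_simps)
    also have "\<dots> \<in> Uq_ideal q n" using that by (simp add: U.I_closed)
    finally show ?thesis .
  qed
  have "KK j * KK i * KKinv j - 1 \<cdot> KK i \<in> Uq_ideal q n"
    by (rule *) (use ij relators in auto)
  then have "KKinv j * KK i - inverse 1 \<cdot> (KK i * KKinv j) \<in> Uq_ideal q n"
    by (rule U.inverse_commute[of "KK j"]) (use ij relators in auto)
  then have 1: "KK i * KKinv j - KKinv j * KK i \<in> Uq_ideal q n"
    using U.I_uminus by fastforce
  have "KK i * KKinv j * KKinv i - 1 \<cdot> KKinv j \<in> Uq_ideal q n"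
    by (rule *) (use ij relators 1 in auto)
  then have "KKinv i * KKinv j - inverse 1 \<cdot> (KKinv j * KKinv i) \<in> Uq_ideal q n"
    by (rule U.inverse_commute[of "KK i"]) (use ij relators in auto)
  then show "KKinv i * KKinv j - KKinv j * KKinv i \<in> Uq_ideal q n" by simp
qed

lemma b_serre:
  assumes ij: "i \<in> {1..n}" "j \<in> {1..n}" and adj: "i = Suc j \<or> j = Suc i"
  shows "qserre q (b i) (b i) (b j) + inverse q \<cdot> b j \<in> Uq_ideal q n"
proof -
  let ?I = "Uq_ideal q n"
  have cart: "cartan i i = 2" "cartan i j = - 1" "cartan j i = - 1" and ne: "i \<noteq> j" "j \<noteq> i"
    using adj by (auto simp: cartan_def)
  note FA = gens_FA[OF ij(1)] gens_FA[OF ij(2)]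
  note rii = relators[OF ij(1) ij(1), unfolded cart, simplified]
  note rij = relators[OF ij, unfolded cart] and rji = relators[OF ij(2,1), unfolded cart]
  note kii = Kinv_relations[OF ij(1) ij(1), unfolded cart, simplified]
  note kij = Kinv_relations[OF ij, unfolded cart, simplified]
  note kji = Kinv_relations[OF ij(2,1), unfolded cart, simplified]
  define x y u v where "x = FF i" and "y = EE i * KKinv i" and "u = FF j" and "v = EE j * KKinv j"
  note xyuv = x_def y_def u_def v_def
  have FAx: "x \<in> FA q (qgens n)" "y \<in> FA q (qgens n)" "u \<in> FA q (qgens n)" "v \<in> FA q (qgens n)"
    using FA by (simp_all add: xyuv)
  define l where "l = q^2 * (1 / (q - inverse q))"
  have l: "l \<in> Qq q" by (simp add: l_def)
  have q1: "q - inverse q \<noteq> 0"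
    using q_nz q_sq by (simp add: field_simps power2_eq_square)
  have l1: "l * (1 - (inverse q)^2) = q"
    using q_nz q1 by (simp add: l_def field_simps power2_eq_square)
  have l2: "l * (1 - q^2) = - (q^3)"
    using q_nz q1 by (simp add: l_def field_simps power2_eq_square power3_eq_cube)
  \<comment> \<open>\<open>E\<^sub>iK\<^sub>i\<inverse>F\<^sub>i = q\<^sup>2E\<^sub>iF\<^sub>iK\<^sub>i\<inverse>\<close>, and the commutator of \<open>E\<^sub>i\<close> and \<open>F\<^sub>i\<close> contributes
    \<open>q\<^sup>2(K\<^sub>i - K\<^sub>i\<inverse>)K\<^sub>i\<inverse>/(q - q\<inverse>)\<close>.\<close>
  define d where "d = l \<cdot> (1 - KKinv i * KKinv i)"
  have FAd: "d \<in> FA q (qgens n)" using FA l by (simp add: d_def)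
  have yx: "y * x - q^2 \<cdot> (x * y) - d \<in> ?I"
  proof -
    define k where "k = 1 / (q - inverse q)"
    have k: "k \<in> Qq q" by (simp add: k_def)
    define E F K L where "E = EE i" and "F = FF i" and "K = KK i" and "L = KKinv i"
    note EFKL = this
    have "y * x - q^2 \<cdot> (x * y) - d =
        E * (L * F - q^2 \<cdot> (F * L)) + q^2 \<cdot> ((E * F - F * E - k \<cdot> (K - L)) * L)
        + (q^2 * k) \<cdot> (K * L - 1)"
      unfolding xyuv d_def l_def k_def[symmetric] EFKL[symmetric] by (simp add: smul_simps algebra_simps)
    also have "\<dots> \<in> ?I"
      unfolding EFKL k_def by (intro U.I_add U.I_lmult U.I_smul U.I_rmult rii kii FA) auto
    finally show ?thesis .
  qed
  have yu: "y * u - inverse q \<cdot> (u * y) \<in> ?I"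
  proof -
    have "y * u - inverse q \<cdot> (u * y) = EE i * (KKinv i * FF j - inverse q \<cdot> (FF j * KKinv i))
        + inverse q \<cdot> ((EE i * FF j - FF j * EE i) * KKinv i)"
      unfolding xyuv by (simp add: smul_simps algebra_simps)
    also have "\<dots> \<in> ?I"
      using rij(6) ne by (intro U.I_add U.I_lmult U.I_smul U.I_rmult kij FA) auto
    finally show ?thesis .
  qed
  have vx: "v * x - inverse q \<cdot> (x * v) \<in> ?I"
  proof -
    have "v * x - inverse q \<cdot> (x * v) = EE j * (KKinv j * FF i - inverse q \<cdot> (FF i * KKinv j))
        + inverse q \<cdot> ((EE j * FF i - FF i * EE j) * KKinv j)"
      unfolding xyuv by (simp add: smul_simps algebra_simps)
    also have "\<dots> \<in> ?I"
      using rji(6) ne by (intro U.I_add U.I_lmult U.I_smul U.I_rmult kji FA) auto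
    finally show ?thesis .
  qed
  have du: "d * u - (inverse q)^2 \<cdot> (u * d) - q \<cdot> u \<in> ?I"
  proof -
    define L where "L = KKinv i"
    define r where "r = L * u - inverse q \<cdot> (u * L)"
    have r: "r \<in> ?I" using kij by (simp add: r_def L_def u_def)
    have "d * u - (inverse q)^2 \<cdot> (u * d) - (l * (1 - (inverse q)^2)) \<cdot> u = - (l \<cdot> (L * r + inverse q \<cdot> (r * L)))"
      unfolding d_def r_def L_def[symmetric] by (simp add: smul_simps algebra_simps power2_eq_square)
    also have "\<dots> \<in> ?I"
      unfolding L_def by (intro U.I_add U.I_lmult U.I_smul U.I_rmult U.I_uminus r FA l) auto
    finally show ?thesis by (simp add: l1)
  qed
  have dv: "d * v - q^2 \<cdot> (v * d) + q^3 \<cdot> v \<in> ?I"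
  proof -
    define L where "L = KKinv i"
    define r where "r = L * v - q \<cdot> (v * L)"
    have "r = (KKinv i * EE j - q \<cdot> (EE j * KKinv i)) * KKinv j
        + q \<cdot> (EE j * (KKinv i * KKinv j - KKinv j * KKinv i))"
      unfolding r_def L_def v_def by (simp add: smul_simps algebra_simps)
    also have "\<dots> \<in> ?I"
      by (intro U.I_add U.I_lmult U.I_smul U.I_rmult kij FA) auto
    finally have r: "r \<in> ?I" .
    have "d * v - q^2 \<cdot> (v * d) - (l * (1 - q^2)) \<cdot> v = - (l \<cdot> (L * r + q \<cdot> (r * L)))"
      unfolding d_def r_def L_def[symmetric] by (simp add: smul_simps algebra_simps power2_eq_square)
    also have "\<dots> \<in> ?I"
      unfolding L_def by (intro U.I_add U.I_lmult U.I_smul U.I_rmult U.I_uminus r FA l) auto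
    finally show ?thesis by (simp add: l2 smul_left_minus)
  qed
  have Su: "qserre q x x u \<in> ?I"
    using rij(8) ne cart by (simp add: serre_relator_eq xyuv)
  have SE: "qserre q (EE i) (EE i) (EE j) \<in> ?I"
    using rij(7) ne cart by (simp add: serre_relator_eq)
  have Sv: "qserre q y y v \<in> ?I"
    unfolding xyuv by (rule U.qserre_twist[OF q_nz FA(1) FA(6) FA(4) FA(9) _ _ _ _ SE])
      (use kii kij kji in \<open>simp_all add: power_inverse\<close>)
  show ?thesis
    unfolding b_eq using U.qserre_inhomogeneous[OF q_nz FAx FAd yx yu vx du dv Su Sv refl]
    by (simp add: xyuv)
qed

lemma b_commute:
  assumes ij: "i \<in> {1..n}" "j \<in> {1..n}" and far: "i \<noteq> j" "i \<noteq> Suc j" "j \<noteq> Suc i"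
  shows "b i * b j - b j * b i \<in> Uq_ideal q n"
proof -
  let ?I = "Uq_ideal q n"
  have cart: "cartan i j = 0" "cartan j i = 0" 
    using far by (auto simp: cartan_def)
  note FA = gens_FA[OF ij(1)] gens_FA[OF ij(2)]
  note rij = relators[OF ij, unfolded cart] and rji = relators[OF ij(2,1), unfolded cart]
  note kij = Kinv_relations[OF ij, unfolded cart, simplified]
  note kji = Kinv_relations[OF ij(2,1), unfolded cart, simplified]
  define c where "c = - ((inverse q)^2)"
  have c: "c \<in> Qq q" by (simp add: c_def)
  have FY: "FF k * (EE m * KKinv m) - EE m * KKinv m * FF k \<in> ?I"
    if "EE m * FF k - FF k * EE m \<in> ?I" "KKinv m * FF k - FF k * KKinv m \<in> ?I" 
      "m \<in> {1..n}" for k m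
  proof -
    have "FF k * (EE m * KKinv m) - EE m * KKinv m * FF k =
        - ((EE m * FF k - FF k * EE m) * KKinv m + EE m * (KKinv m * FF k - FF k * KKinv m))"
      by (simp add: algebra_simps)
    also have "\<dots> \<in> ?I"
      by (intro U.I_add U.I_lmult U.I_rmult U.I_uminus that gens_FA)
    finally show ?thesis .
  qed
  have YY: "EE i * KKinv i * (EE j * KKinv j) - EE j * KKinv j * (EE i * KKinv i) \<in> ?I"
  proof -
    define E K G L where "E = EE i" and "K = KKinv i" and "G = EE j" and "L = KKinv j"
    note EKGL = this
    have "E * K * (G * L) - G * L * (E * K) =
        E * (K * G - G * K) * L + (E * G - G * E) * (K * L) - G * (L * E - E * L) * K
        + G * E * (K * L - L * K)"
      by (simp add: algebra_simps)
    also have "\<dots> \<in> ?I"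
      unfolding EKGL using rij(7) far cart kij kji FA
      by (simp add: serre_relator_eq U.I_closed)
    finally show ?thesis by (simp add: EKGL)
  qed
  have FF: "FF i * FF j - FF j * FF i \<in> ?I"
    using rij(8) far cart by (simp add: serre_relator_eq)
  define x y u v where "x = FF i" and "y = EE i * KKinv i" and "u = FF j" and "v = EE j * KKinv j"
  note xyuv = x_def y_def u_def v_def
  have "b i * b j - b j * b i = (x * u - u * x) + c \<cdot> (x * v - v * x) - c \<cdot> (u * y - y * u)
      + c \<cdot> c \<cdot> (y * v - v * y)"
    unfolding b_eq unfolding xyuv[symmetric] c_def[symmetric] by (simp add: smul_simps algebra_simps)
  also have "\<dots> \<in> ?I"
  proof -
    have "x * u - u * x \<in> ?I" "x * v - v * x \<in> ?I" "u * y - y * u \<in> ?I" "y * v - v * y \<in> ?I"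
      unfolding xyuv using FF YY FY[OF _ _ ij(1), of j] FY[OF _ _ ij(2), of i] rij(6) rji(6) far kij kji
      by auto
    then show ?thesis using c by (simp add: U.I_closed)
  qed
  finally show ?thesis .
qed

end

section \<open>The evaluation of noncommutative polynomials at the generators \<open>B\<^sub>i\<close>\<close>

text \<open>The letters are numbered from one; this keeps \<open>{1..n}\<close> in the form it has in the carriers.\<close>

declare One_nat_def [simp del]

context iquantum
begin

abbreviation "TT \<equiv> FA q {1..n}"

text \<open>
  The evaluation \<open>x \<mapsto> B\<^sub>x\<close> on \<open>T(V)\<close>, factored through the free algebra of the quantum group. In
  this form it is visibly multiplicative, and the relations of the \<open>B\<^sub>i\<close> become congruences between
  noncommutative polynomials.
\<close>

definition Phi :: "nat falg \<Rightarrow> qgen falg set" where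
  "Phi x = Uq_class q n (subst b x)"

lemma ring_Uq: "ring (Uq q n)"
  unfolding Uq_def by (rule ideal.quotient_is_ring[OF U.is_ideal])

lemma class_hom: "Uq_class q n \<in> ring_hom (Uq_free q n) (Uq q n)"
  using ideal.rcos_ring_hom[OF U.is_ideal] unfolding Uq_def Uq_class_def[abs_def] .

lemma class_in: "x \<in> FA q (qgens n) \<Longrightarrow> Uq_class q n x \<in> carrier (Uq q n)"
  by (rule ring_hom_closed[OF class_hom])

lemma class_mult: "x \<in> FA q (qgens n) \<Longrightarrow> y \<in> FA q (qgens n) \<Longrightarrow>
    Uq_class q n (x * y) = Uq_class q n x \<otimes>\<^bsub>Uq q n\<^esub> Uq_class q n y"
  using ring_hom_mult[OF class_hom] by simp

lemma class_add: "x \<in> FA q (qgens n) \<Longrightarrow> y \<in> FA q (qgens n) \<Longrightarrow>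
    Uq_class q n (x + y) = Uq_class q n x \<oplus>\<^bsub>Uq q n\<^esub> Uq_class q n y"
  using ring_hom_add[OF class_hom] by simp

lemma class_one: "Uq_class q n 1 = \<one>\<^bsub>Uq q n\<^esub>"
  using ring_hom_one[OF class_hom] by simp

lemma class_eq_iff:
  assumes "x \<in> FA q (qgens n)" "y \<in> FA q (qgens n)"
  shows "Uq_class q n x = Uq_class q n y \<longleftrightarrow> x - y \<in> Uq_ideal q n"
proof -
  interpret R: ring "Uq_free q n" by (rule ring_free_algebra)
  have "x \<ominus>\<^bsub>Uq_free q n\<^esub> y = x - y"
    using assms by (simp add: a_minus_def free_algebra_a_inv)
  then show ?thesis
    using R.quotient_eq_iff_same_a_r_cos[OF U.is_ideal, of x y] assms by (simp add: Uq_class_def)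
qed

lemma Ui_generators: "Uscal q n ` Qq q \<union> Bgen q n ` {1..n} \<subseteq> carrier (Uq q n)"
  by (auto simp: Uscal_def Bgen_def intro!: class_in gens_FA)

lemma ring_Ui: "ring (Ui q n)"
  unfolding Ui_def by (rule ring.generate_ring_is_ring[OF ring_Uq Ui_generators])

lemma Ui_ops [simp]:
  "x \<otimes>\<^bsub>Ui q n\<^esub> y = x \<otimes>\<^bsub>Uq q n\<^esub> y" "x \<oplus>\<^bsub>Ui q n\<^esub> y = x \<oplus>\<^bsub>Uq q n\<^esub> y"
  "\<one>\<^bsub>Ui q n\<^esub> = \<one>\<^bsub>Uq q n\<^esub>" "\<zero>\<^bsub>Ui q n\<^esub> = \<zero>\<^bsub>Uq q n\<^esub>"
  by (simp_all add: Ui_def)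

lemma Ui_closed:
  shows "i \<in> {1..n} \<Longrightarrow> Bgen q n i \<in> carrier (Ui q n)"
    and "c \<in> Qq q \<Longrightarrow> Uscal q n c \<in> carrier (Ui q n)"
  by (auto simp: Ui_def intro!: generate_ring.incl)

lemma subst_b_FA: "x \<in> TT \<Longrightarrow> subst b x \<in> FA q (qgens n)"
  by (rule subst_in_FA) (rule gens_FA(5), assumption)

lemma Phi_add: "x \<in> TT \<Longrightarrow> y \<in> TT \<Longrightarrow> Phi (x + y) = Phi x \<oplus>\<^bsub>Ui q n\<^esub> Phi y"
  by (simp add: Phi_def subst_add class_add subst_b_FA)

lemma Phi_mult: "x \<in> TT \<Longrightarrow> y \<in> TT \<Longrightarrow> Phi (x * y) = Phi x \<otimes>\<^bsub>Ui q n\<^esub> Phi y"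
  by (simp add: Phi_def subst_mult class_mult subst_b_FA)

lemma Phi_1: "Phi 1 = \<one>\<^bsub>Ui q n\<^esub>"
  by (simp add: Phi_def class_one)

lemma Phi_scal: "Phi (scal c) = Uscal q n c"
  by (simp add: Phi_def Uscal_def subst_scal)

lemma Phi_letter: "Phi (word [i]) = Bgen q n i"
  by (simp add: Phi_def Bgen_def subst_word)

lemma Phi_word_in: "set w \<subseteq> {1..n} \<Longrightarrow> Phi (word w) \<in> carrier (Ui q n)"
proof (induction w)
  case Nil
  then show ?case using ring.ring_simprules(6)[OF ring_Ui] by (simp add: Phi_1)
next
  case (Cons i w)
  have "Phi (word (i # w)) = Phi (word [i] * word w)" by (simp add: word_mult)
  also have "\<dots> = Phi (word [i]) \<otimes>\<^bsub>Ui q n\<^esub> Phi (word w)"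
    using Cons by (intro Phi_mult) auto
  also have "Phi (word [i]) = Bgen q n i" by (rule Phi_letter)
  finally show ?case
    using Cons ring.ring_simprules(5)[OF ring_Ui] Ui_closed(1)[of i] by simp
qed

lemma Phi_in: "x \<in> TT \<Longrightarrow> Phi x \<in> carrier (Ui q n)"
proof (induction rule: FA_induct)
  case zero
  show ?case using Ui_closed(2)[of 0] by (simp flip: Phi_scal)
next
  case (single w c)
  have "Phi (Poly_Mapping.single w c) = Uscal q n c \<otimes>\<^bsub>Ui q n\<^esub> Phi (word w)"
    using single Phi_mult[of "scal c" "word w"] by (simp only: Phi_scal single_conv_smul smul_def) auto
  then show ?case
    using single ring.ring_simprules(5)[OF ring_Ui Ui_closed(2) Phi_word_in] by simp
next
  case (add x y)
  then show ?case using ring.ring_simprules(1)[OF ring_Ui] Phi_add by simp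
qed

lemma Phi_ring_hom: "Phi \<in> ring_hom (TV q n) (Ui q n)"
  by (rule ring_hom_memI) (simp_all add: Phi_in Phi_mult[simplified] Phi_add[simplified] Phi_1[simplified])

sublocale Phi: ring_hom_ring "TV q n" "Ui q n" Phi
  by (rule ring_hom_ringI2[OF ring_free_algebra ring_Ui Phi_ring_hom])

sublocale T: falg_ideal q "{1..n}" "a_kernel (TV q n) (Ui q n) Phi"
  by (rule falg_ideal.intro) (rule Phi.kernel_is_ideal)

notation T.eqv (infix \<open>\<approx>\<close> 50)

lemma Phi_eq_iff:
  assumes "x \<in> TT" "y \<in> TT"
  shows "Phi x = Phi y \<longleftrightarrow> subst b x - subst b y \<in> Uq_ideal q n"
  unfolding Phi_def using assms by (intro class_eq_iff subst_b_FA)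

lemma Phi_0: "Phi 0 = \<zero>\<^bsub>Ui q n\<^esub>"
  using Phi.hom_zero by (simp only: free_algebra_simps)

lemma eqv_iff: "x \<approx> y \<longleftrightarrow> x \<in> TT \<and> y \<in> TT \<and> Phi x = Phi y"
proof -
  have "x - y \<in> a_kernel (TV q n) (Ui q n) Phi \<longleftrightarrow> Phi x = Phi y" if "x \<in> TT" "y \<in> TT"
  proof -
    have "x - y \<in> a_kernel (TV q n) (Ui q n) Phi \<longleftrightarrow> Phi (x - y) = Phi 0"
      using FA_diff[OF that] unfolding a_kernel_def' Phi_0 by blast
    also have "\<dots> \<longleftrightarrow> Phi x = Phi y"
      using Phi_eq_iff[OF FA_diff[OF that] FA_0] Phi_eq_iff[OF that]
      by (simp only: subst_diff subst_0 diff_zero)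
    finally show ?thesis .
  qed
  then show ?thesis unfolding T.eqv_def by blast
qed

lemma eqvI: "x \<in> TT \<Longrightarrow> y \<in> TT \<Longrightarrow> subst b x - subst b y \<in> Uq_ideal q n \<Longrightarrow> x \<approx> y"
  using Phi_eq_iff[of x y] by (simp only: eqv_iff)

lemma Bword_eq: "set w \<subseteq> {1..n} \<Longrightarrow> Bword q n w = Phi (word w)"
proof (induction w)
  case (Cons i w)
  have "Phi (word (i # w)) = Phi (word [i] * word w)" by (simp add: word_mult)
  also have "\<dots> = Phi (word [i]) \<otimes>\<^bsub>Ui q n\<^esub> Phi (word w)"
    using Cons by (intro Phi_mult) auto
  finally show ?case using Cons by (simp add: Bword_def ordered_prod_def Phi_letter)
qed (simp add: Bword_def ordered_prod_def Phi_1)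

lemma finsum_Phi:
  assumes "finite A" "f ` A \<subseteq> TT"
  shows "(\<Oplus>\<^bsub>Ui q n\<^esub>w\<in>A. Phi (f w)) = Phi (sum f A)"
  using assms
proof (induction A)
  case empty
  then show ?case by (simp only: Phi.S.finsum_empty sum.empty Phi_0)
next
  case (insert a A)
  then have "(\<Oplus>\<^bsub>Ui q n\<^esub>w\<in>insert a A. Phi (f w)) = Phi (f a) \<oplus>\<^bsub>Ui q n\<^esub> (\<Oplus>\<^bsub>Ui q n\<^esub>w\<in>A. Phi (f w))"
    by (intro Phi.S.finsum_insert) (auto intro!: Phi_in)
  also have "\<dots> = Phi (f a + sum f A)"
    using insert by (subst Phi_add) (auto intro!: FA_sum)
  finally show ?case using insert by simp
qed

lemma Blin_eq: "x \<in> TT \<Longrightarrow> Blin q n x = Phi x"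
proof -
  assume x: "x \<in> TT"
  let ?f = "\<lambda>w. Poly_Mapping.single w (coef x w)"
  have f: "?f ` supp x \<subseteq> TT" and s: "\<And>w. w \<in> supp x \<Longrightarrow> set w \<subseteq> {1..n}"
    using x by (auto simp: FA_iff intro!: FA_single)
  have "Uscal q n (coef x w) \<otimes>\<^bsub>Ui q n\<^esub> Bword q n w = Phi (?f w)" if "w \<in> supp x" for w
  proof -
    have c: "coef x w \<in> Qq q" using x by (simp add: FA_iff)
    have "Phi (?f w) = Phi (scal (coef x w)) \<otimes>\<^bsub>Ui q n\<^esub> Phi (word w)"
      unfolding single_conv_smul smul_def by (rule Phi_mult) (use c s[OF that] in auto)
    then show ?thesis by (simp only: Phi_scal Bword_eq[OF s[OF that]])
  qed
  then have "Blin q n x = (\<Oplus>\<^bsub>Ui q n\<^esub>w\<in>supp x. Phi (?f w))"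
    unfolding Blin_def using f
    by (intro Phi.S.finsum_cong') (auto intro!: Phi_in)
  also have "\<dots> = Phi (\<Sum>w\<in>supp x. ?f w)"
    by (rule finsum_Phi) (use f in auto)
  also have "(\<Sum>w\<in>supp x. ?f w) = x"
    by (rule poly_mapping_eqI) (auto simp: lookup_sum lookup_single when_def in_keys_iff)
  finally show ?thesis .
qed

lemma ordered_prod_Phi:
  "set xs \<subseteq> TT \<Longrightarrow> ordered_prod (Ui q n) (map Phi xs) = Phi (prod_list xs)"
  by (induction xs) (auto simp: ordered_prod_def Phi_1[simplified] Phi_mult[simplified] FA_prod_list)

lemma Phi_power: "x \<in> TT \<Longrightarrow> Phi x [^]\<^bsub>Ui q n\<^esub> (m :: nat) = Phi (x ^ m)"
  by (induction m) (simp_all add: Phi_1[simplified] Phi_mult[simplified] power_Suc2 del: power_Suc)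

abbreviation "v i \<equiv> word [i]"

lemma v_TT [simp]: "i \<in> {1..n} \<Longrightarrow> v i \<in> TT"
  by auto

lemma v_commute:
  assumes "i \<in> {1..n}" "j \<in> {1..n}" "i \<noteq> j" "i \<noteq> Suc j" "j \<noteq> Suc i"
  shows "v i * v j \<approx> v j * v i"
  by (rule eqvI) (use assms b_commute[OF assms] in \<open>auto simp: subst_simps\<close>)

lemma v_serre:
  assumes "i \<in> {1..n}" "j \<in> {1..n}" "i = Suc j \<or> j = Suc i"
  shows "qserre q (v i) (v i) (v j) \<approx> - (inverse q \<cdot> v j)"
  by (rule eqvI) (use assms b_serre[OF assms] in \<open>auto simp: subst_simps qserre_def\<close>)

end

section \<open>Braid group action and root vectors\<close>

text \<open>
  The iterated bracket of the letters \<open>a, \<dots>, a + d\<close>. It will appear both as the bracketing of this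
  Lyndon word and as a root vector.
\<close>

primrec br :: "complex \<Rightarrow> nat \<Rightarrow> nat \<Rightarrow> nat falg" where
  "br q a 0 = word [a]"
| "br q a (Suc d) = br q a d * word [a + Suc d] - q \<cdot> (word [a + Suc d] * br q a d)"

lemma br_FA: "{a..a + d} \<subseteq> S \<Longrightarrow> br q a d \<in> FA q S"
proof (induction d)
  case (Suc d)
  then have "{a..a + d} \<subseteq> S" "a + Suc d \<in> S" by auto
  then show ?case using Suc.IH by (simp add: FA_word)
qed (simp add: FA_word)

text \<open>The substitution which \<open>\<tau>\<^sub>i\<close> performs on the letters.\<close>

definition sig :: "complex \<Rightarrow> nat \<Rightarrow> nat falg \<Rightarrow> nat falg" where
  "sig q i = subst (\<lambda>j. if i = Suc j \<or> j = Suc i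
     then word [i] * word [j] - q \<cdot> (word [j] * word [i]) else word [j])"

lemma sig_letter:
  "sig q i (word [j]) = (if i = Suc j \<or> j = Suc i
     then word [i] * word [j] - q \<cdot> (word [j] * word [i]) else word [j])"
  by (simp add: sig_def subst_word)

lemma foldr_sig_hom:
  "foldr (sig q) L (x * y) = foldr (sig q) L x * foldr (sig q) L y"
  "foldr (sig q) L (x + y) = foldr (sig q) L x + foldr (sig q) L y"
  "foldr (sig q) L (x - y) = foldr (sig q) L x - foldr (sig q) L y"
  "foldr (sig q) L (- x) = - foldr (sig q) L x"
  "foldr (sig q) L (c \<cdot> x) = c \<cdot> foldr (sig q) L x"
  by (induction L) (simp_all add: sig_def subst_simps)

lemma foldr_sig_qserre:
  "foldr (sig q) L (qserre q x y z) =
     qserre q (foldr (sig q) L x) (foldr (sig q) L y) (foldr (sig q) L z)"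
  by (simp add: qserre_def foldr_sig_hom)

lemma foldr_sig_fixed:
  "(\<And>k. k \<in> set L \<Longrightarrow> k \<noteq> Suc j \<and> j \<noteq> Suc k) \<Longrightarrow> foldr (sig q) L (word [j]) = word [j]"
  by (induction L) (auto simp: sig_letter)

text \<open>
  Only the last automorphism affects the letter; the factor \<open>v\<^sub>a\<^sub>+\<^sub>d\<close> which it produces is fixed by
  the others.
\<close>

lemma foldr_sig_br: "foldr (sig q) [a..<a + d] (word [a + d]) = br q a d"
proof (induction d)
  case (Suc d)
  have "foldr (sig q) [a..<a + Suc d] (word [a + Suc d]) =
      foldr (sig q) [a..<a + d] (sig q (a + d) (word [a + Suc d]))"
    by simp
  also have "foldr (sig q) [a..<a + d] (word [a + Suc d]) = word [a + Suc d]"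
    by (rule foldr_sig_fixed) auto
  then have "foldr (sig q) [a..<a + d] (sig q (a + d) (word [a + Suc d])) = br q a (Suc d)"
    using Suc.IH by (simp add: sig_letter foldr_sig_hom)
  finally show ?case .
qed simp

lemma sig_FA: "i \<in> S \<Longrightarrow> x \<in> FA q S \<Longrightarrow> sig q i x \<in> FA q S"
  unfolding sig_def by (rule subst_in_FA) auto

lemma foldr_sig_FA: "set L \<subseteq> S \<Longrightarrow> x \<in> FA q S \<Longrightarrow> foldr (sig q) L x \<in> FA q S"
  by (induction L) (auto intro: sig_FA)

context iquantum
begin

lemma Phi_diff:
  assumes "x \<in> TT" "y \<in> TT" shows "Phi (x - y) = Phi x \<ominus>\<^bsub>Ui q n\<^esub> Phi y"
proof -
  have "Phi (- y) = \<ominus>\<^bsub>Ui q n\<^esub> Phi y"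
    using Phi.hom_a_inv[OF assms(2)] assms(2) by (simp only: free_algebra_a_inv)
  then show ?thesis
    using Phi_add[OF assms(1) FA_uminus[OF assms(2)]] by (simp add: a_minus_def)
qed

end

locale iquantum_braid = iquantum +
  fixes \<tau> :: "nat \<Rightarrow> qgen falg set \<Rightarrow> qgen falg set"
  assumes braid: "braid_automorphisms q n \<tau>"
begin

lemma tau:
  assumes "i \<in> {1..n}"
  shows tau_hom: "\<tau> i \<in> ring_hom (Ui q n) (Ui q n)"
    and tau_scal: "c \<in> Qq q \<Longrightarrow> \<tau> i (Phi (scal c)) = Phi (scal c)"
    and tau_letter: "j \<in> {1..n} \<Longrightarrow> \<tau> i (Phi (v j)) = Phi (sig q i (v j))"
proof -
  note B = braid[unfolded braid_automorphisms_def, rule_format, OF assms]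
  show "\<tau> i \<in> ring_hom (Ui q n) (Ui q n)" using B by (simp add: ring_iso_def)
  show "c \<in> Qq q \<Longrightarrow> \<tau> i (Phi (scal c)) = Phi (scal c)" using B by (simp add: Phi_scal)
  assume j: "j \<in> {1..n}"
  have "Phi (v i * v j - q \<cdot> (v j * v i)) = Phi (v i) \<otimes>\<^bsub>Ui q n\<^esub> Phi (v j)
          \<ominus>\<^bsub>Ui q n\<^esub> Phi (scal q) \<otimes>\<^bsub>Ui q n\<^esub> Phi (v j) \<otimes>\<^bsub>Ui q n\<^esub> Phi (v i)"
  proof -
    have "q \<cdot> (v j * v i) = scal q * v j * v i" by (simp add: smul_def mult.assoc)
    moreover have "scal q * v j \<in> TT" using j by auto
    ultimately show ?thesis
      using assms j by (simp only: Phi_diff Phi_mult v_TT FA_mult FA_scal Qq_gen)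
  qed
  then show "\<tau> i (Phi (v j)) = Phi (sig q i (v j))"
    using B j by (simp add: sig_letter Phi_letter Phi_scal del: Ui_ops)
qed

lemma tau_Phi:
  assumes i: "i \<in> {1..n}" and x: "x \<in> TT"
  shows "\<tau> i (Phi x) = Phi (sig q i x)"
proof -
  note hom = tau_hom[OF i]
  have S: "sig q i y \<in> TT" if "y \<in> TT" for y by (rule sig_FA[OF i that])
  have mult: "\<tau> i (Phi (x * y)) = Phi (sig q i (x * y))"
    if "x \<in> TT" "y \<in> TT" "\<tau> i (Phi x) = Phi (sig q i x)" "\<tau> i (Phi y) = Phi (sig q i y)" for x y
  proof -
    have "sig q i (x * y) = sig q i x * sig q i y" by (simp add: sig_def subst_mult)
    then show ?thesis
      using that ring_hom_mult[OF hom Phi_in[OF that(1)] Phi_in[OF that(2)]]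
      by (simp only: Phi_mult S)
  qed
  have sc: "\<tau> i (Phi (scal c)) = Phi (sig q i (scal c))" if "c \<in> Qq q" for c
    using tau_scal[OF i that] by (simp add: sig_def subst_scal)
  have w: "\<tau> i (Phi (word w)) = Phi (sig q i (word w))" if "set w \<subseteq> {1..n}" for w
    using that
  proof (induction w)
    case Nil
    then show ?case using sc[of 1] by simp
  next
    case (Cons j w)
    then show ?case using mult[of "v j" "word w"] tau_letter[OF i] by (simp add: word_mult)
  qed
  from x show ?thesis
  proof (induction rule: FA_induct)
    case zero
    then show ?case using sc[of 0] by simp
  next
    case (single w c)
    then show ?case
      using mult[of "scal c" "word w"] sc w by (simp add: single_conv_smul smul_def)
  next
    case (add x y)
    have "sig q i (x + y) = sig q i x + sig q i y" by (simp add: sig_def subst_add)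
    then show ?case
      using add ring_hom_add[OF hom Phi_in[OF add(1)] Phi_in[OF add(2)]]
      by (simp only: Phi_add S)
  qed
qed

lemma foldr_tau_Phi:
  "set L \<subseteq> {1..n} \<Longrightarrow> x \<in> TT \<Longrightarrow> foldr \<tau> L (Phi x) = Phi (foldr (sig q) L x)"
  by (induction L) (simp_all add: tau_Phi foldr_sig_FA)

lemma foldr_sig_eqv:
  assumes "set L \<subseteq> {1..n}" "x \<approx> y"
  shows "foldr (sig q) L x \<approx> foldr (sig q) L y"
  using assms foldr_tau_Phi[OF assms(1), of x] foldr_tau_Phi[OF assms(1), of y]
  by (simp add: eqv_iff foldr_sig_FA)

text \<open>
  The left hand side is the Serre expression up to the factor \<open>- q\<close>. The choice \<open>\<xi>\<^sub>i = - q\<^sup>-\<^sup>2\<close> is what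
  makes the inhomogeneous term of the Serre relation equal to \<open>- q\<inverse> B\<^sub>i\<^sub>+\<^sub>1\<close> and the coefficient of
  \<open>v\<^sub>i\<^sub>+\<^sub>1\<close> equal to one.
\<close>

lemma sig_sig_letter:
  assumes "i \<in> {1..n}" "Suc i \<in> {1..n}"
  shows "sig q i (sig q (Suc i) (v i)) \<approx> v (Suc i)"
proof -
  have "sig q i (sig q (Suc i) (v i)) = - (q \<cdot> qserre q (v i) (v i) (v (Suc i)))"
  proof -
    have hom: "sig q i (x * y) = sig q i x * sig q i y" "sig q i (x - y) = sig q i x - sig q i y"
      "sig q i (q \<cdot> x) = q \<cdot> sig q i x" for x y
      by (simp_all add: sig_def subst_simps)
    have 1: "sig q (Suc i) (v i) = v (Suc i) * v i - q \<cdot> (v i * v (Suc i))"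
      "sig q i (v i) = v i" "sig q i (v (Suc i)) = v i * v (Suc i) - q \<cdot> (v (Suc i) * v i)"
      by (simp_all add: sig_letter)
    show ?thesis
      unfolding 1(1) hom 1(2,3) using q_nz by (simp add: monomial_simps)
  qed
  also have "\<dots> = (- q) \<cdot> qserre q (v i) (v i) (v (Suc i))"
    by (simp add: smul_left_minus)
  also have "\<dots> \<approx> (- q) \<cdot> (- (inverse q \<cdot> v (Suc i)))"
    by (rule T.eqv_smul) (use assms v_serre in auto)
  also have "(- q) \<cdot> (- (inverse q \<cdot> v (Suc i))) = v (Suc i)"
    using q_nz by (simp add: smul_left_minus smul_minus smul_cancel)
  finally show ?thesis .
qed

text \<open>
  The Coxeter element \<open>s\<^sub>a \<cdots> s\<^sub>m\<close> maps \<open>\<alpha>\<^sub>i\<close> to \<open>\<alpha>\<^sub>i\<^sub>+\<^sub>1\<close> for \<open>a \<le> i < m\<close>, and the product of the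
  \<open>\<tau>\<close>'s acts on the letters in the same way.
\<close>

lemma foldr_sig_shift_letter:
  assumes "1 \<le> a" "a \<le> i" "i < m" "m \<le> n"
  shows "foldr (sig q) [a..<Suc m] (v i) \<approx> v (Suc i)"
proof -
  have "[a..<Suc m] = [a..<i] @ [i..<Suc m]"
    using upt_add_eq_append[of a i "Suc m - i"] assms by simp
  also have "[i..<Suc m] = i # Suc i # [Suc (Suc i)..<Suc m]"
    using assms by (simp add: upt_conv_Cons)
  finally have "foldr (sig q) [a..<Suc m] (v i) =
      foldr (sig q) [a..<i] (sig q i (sig q (Suc i) (foldr (sig q) [Suc (Suc i)..<Suc m] (v i))))"
    by simp
  also have "foldr (sig q) [Suc (Suc i)..<Suc m] (v i) = v i"
    by (rule foldr_sig_fixed) auto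
  also have "foldr (sig q) [a..<i] (sig q i (sig q (Suc i) (v i))) \<approx> foldr (sig q) [a..<i] (v (Suc i))"
    by (rule foldr_sig_eqv) (use assms sig_sig_letter[of i] in auto)
  also have "foldr (sig q) [a..<i] (v (Suc i)) = v (Suc i)"
    by (rule foldr_sig_fixed) auto
  finally show ?thesis .
qed

lemma foldr_sig_shift_br:
  assumes "1 \<le> a" "a \<le> i" "i + d < m" "m \<le> n"
  shows "foldr (sig q) [a..<Suc m] (br q i d) \<approx> br q (Suc i) d"
  using assms(3)
proof (induction d)
  case 0
  then show ?case using foldr_sig_shift_letter assms by simp
next
  case (Suc d)
  have "foldr (sig q) [a..<Suc m] (v (i + Suc d)) \<approx> v (Suc (i + Suc d))"
    by (rule foldr_sig_shift_letter) (use assms Suc.prems in auto)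
  moreover have "foldr (sig q) [a..<Suc m] (br q i d) \<approx> br q (Suc i) d"
    using Suc by simp
  ultimately show ?case
    unfolding br.simps foldr_sig_hom by (auto intro!: T.eqv_intros)
qed

lemma br_TT: "1 \<le> i \<Longrightarrow> i + d \<le> n \<Longrightarrow> br q i d \<in> TT"
  by (rule br_FA) auto

text \<open>
  Preimages in \<open>T(V)\<close> of the root vectors belonging to a word in the simple reflections. The list is
  recursive in the blocks of the word, which is how \<open>w\<^sub>0\<close> will be processed.
\<close>

definition roots :: "nat list \<Rightarrow> nat falg list" where
  "roots L = map (\<lambda>k. foldr (sig q) (take k L) (v (L ! k))) [0..<length L]"

lemma roots_append: "roots (L @ M) = roots L @ map (foldr (sig q) L) (roots M)"
proof -
  have "[0..<length (L @ M)] = [0..<length L] @ map (\<lambda>k. length L + k) [0..<length M]"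
    using upt_add_eq_append[of 0 "length L" "length M"] map_add_upt[of "length L" "length M"]
    by (simp add: add.commute)
  then show ?thesis
    by (simp add: roots_def nth_append)
qed

lemma roots_upt: "roots [1..<Suc m] = map (br q 1) [0..<m]"
proof (rule nth_equalityI)
  fix k assume "k < length (roots [1..<Suc m])"
  then have k: "k < m" by (simp add: roots_def del: upt_Suc)
  then have "roots [1..<Suc m] ! k = foldr (sig q) [1..<1 + k] (v (1 + k))"
    by (simp add: roots_def nth_upt take_upt del: upt_Suc)
  then show "roots [1..<Suc m] ! k = map (br q 1) [0..<m] ! k"
    using k by (simp only: foldr_sig_br) simp
qed (simp add: roots_def)

end

text \<open>
  The pair \<open>(i, d)\<close> stands for the interval \<open>i, \<dots>, i + d\<close>, that is for the positive root
  \<open>\<alpha>\<^sub>i + \<cdots> + \<alpha>\<^sub>i\<^sub>+\<^sub>d\<close>; the list enumerates these in the order \<open>\<beta>\<^sub>1, \<dots>, \<beta>\<^sub>N\<close>.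
\<close>

definition intervals :: "nat \<Rightarrow> (nat \<times> nat) list" where
  "intervals m = concat (map (\<lambda>i. map (Pair i) [0..<Suc m - i]) [1..<Suc m])"

lemma intervals_Suc:
  "intervals (Suc m) = map (Pair 1) [0..<Suc m] @ map (\<lambda>(i, d). (Suc i, d)) (intervals m)"
proof -
  have "[1..<Suc (Suc m)] = 1 # map Suc [1..<Suc m]"
    by (simp add: upt_conv_Cons map_Suc_upt)
  then show ?thesis
    by (simp add: intervals_def map_concat o_def)
qed

lemma set_intervals: "set (intervals m) = {(i, d). 1 \<le> i \<and> i + d \<le> m}"
  by (auto simp: intervals_def)

lemma longest_word_Suc: "longest_word (Suc m) = [1..<Suc (Suc m)] @ longest_word m"
  by (simp add: longest_word_def)

lemma set_longest_word: "set (longest_word m) \<subseteq> {1..m}"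
  by (auto simp: longest_word_def)

lemma length_longest_word: "length (longest_word m) = num_pos_roots m"
proof (induction m)
  case (Suc m)
  have "length (longest_word (Suc m)) = Suc m + m * (m + 1) div 2"
    using Suc unfolding longest_word_Suc length_append length_upt num_pos_roots_def by simp
  also have "\<dots> = (2 * Suc m + m * (m + 1)) div 2" by simp
  also have "2 * Suc m + m * (m + 1) = Suc m * (Suc m + 1)" by (simp add: algebra_simps)
  finally show ?case by (simp only: num_pos_roots_def)
qed (simp add: longest_word_def num_pos_roots_def)

context iquantum_braid
begin

text \<open>
  The first block of \<open>w\<^sub>0\<close> gives the intervals starting at one, and shifts by one the intervals that
  come from the remaining blocks.
\<close>

lemma roots_longest_word:
  "m \<le> n \<Longrightarrow> list_all2 (\<approx>) (roots (longest_word m)) (map (\<lambda>(i, d). br q i d) (intervals m))"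
proof (induction m)
  case 0
  then show ?case by (simp add: longest_word_def roots_def intervals_def)
next
  case (Suc m)
  let ?br = "\<lambda>(i, d). br q i d"
  have "list_all2 (\<lambda>x y. foldr (sig q) [1..<Suc (Suc m)] x \<approx> foldr (sig q) [1..<Suc (Suc m)] y)
      (roots (longest_word m)) (map ?br (intervals m))"
    by (rule list_all2_mono[OF Suc.IH]) (use Suc.prems in \<open>auto simp del: upt_Suc intro!: foldr_sig_eqv\<close>)
  then have "list_all2 (\<approx>) (map (foldr (sig q) [1..<Suc (Suc m)]) (roots (longest_word m)))
      (map (foldr (sig q) [1..<Suc (Suc m)]) (map ?br (intervals m)))"
    by (simp only: list_all2_map1 list_all2_map2)
  moreover have "list_all2 (\<approx>) (map (foldr (sig q) [1..<Suc (Suc m)]) (map ?br (intervals m)))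
      (map (\<lambda>(i, d). br q (Suc i) d) (intervals m))"
    using Suc.prems foldr_sig_shift_br[of 1 _ _ "Suc m"]
    by (auto simp: list_all2_map1 list_all2_map2 list_all2_same set_intervals simp del: upt_Suc)
  ultimately have "list_all2 (\<approx>) (map (foldr (sig q) [1..<Suc (Suc m)]) (roots (longest_word m)))
      (map (\<lambda>(i, d). br q (Suc i) d) (intervals m))"
    by (rule list_all2_trans[rotated]) (rule T.eqv_trans)
  moreover have "list_all2 (\<approx>) (roots [1..<Suc (Suc m)]) (map (br q 1) [0..<Suc m])"
    unfolding roots_upt using Suc.prems
    by (auto simp: list_all2_map1 list_all2_map2 list_all2_same simp del: upt_Suc intro!: T.eqv_refl br_TT)
  ultimately have "list_all2 (\<approx>) (roots (longest_word (Suc m)))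
      (map (br q 1) [0..<Suc m] @ map (\<lambda>(i, d). br q (Suc i) d) (intervals m))"
    unfolding longest_word_Suc roots_append by (intro list_all2_appendI)
  then show ?case
    by (simp add: intervals_Suc case_prod_unfold o_def del: upt_Suc)
qed

lemma length_intervals: "length (intervals n) = num_pos_roots n"
  using list_all2_lengthD[OF roots_longest_word[OF order_refl]]
  by (simp add: roots_def length_longest_word)

lemma root_vector_eq:
  assumes "1 \<le> j" "j \<le> num_pos_roots n" "intervals n ! (j - 1) = (i, d)"
  shows "root_vector q n \<tau> j = Phi (br q i d)"
proof -
  let ?L = "longest_word n"
  have j: "j - 1 < length ?L" "j - 1 < length (intervals n)"
    using assms by (auto simp: length_longest_word length_intervals)
  have L: "set (take (j - 1) ?L) \<subseteq> {1..n}" "?L ! (j - 1) \<in> {1..n}"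
    using set_longest_word[of n] j set_take_subset[of "j - 1" ?L] nth_mem[of "j - 1" ?L] by blast+
  have "root_vector q n \<tau> j = Phi (roots ?L ! (j - 1))"
    using foldr_tau_Phi[OF L(1) v_TT[OF L(2)]] j by (simp add: root_vector_def Phi_letter roots_def)
  moreover have "roots ?L ! (j - 1) \<approx> br q i d"
    using list_all2_nthD2[OF roots_longest_word[OF order_refl], of "j - 1"] j assms(3) by simp
  ultimately show ?thesis by (simp add: eqv_iff)
qed

end

section \<open>Bracketing of intervals\<close>

definition ival :: "nat \<Rightarrow> nat \<Rightarrow> nat list" where
  "ival i d = [i..<Suc (i + d)]"

lemma ival_0 [simp]: "ival i 0 = [i]"
  by (simp add: ival_def)

lemma ival_Suc: "ival i (Suc d) = ival i d @ [i + Suc d]"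
  by (simp add: ival_def)

lemma ival_Cons: "ival i (Suc d) = i # ival (Suc i) d"
  unfolding ival_def by (subst upt_conv_Cons) auto

lemma ival_append: "ival i (d + Suc e) = ival i d @ ival (i + Suc d) e"
  using upt_add_eq_append[of i "Suc (i + d)" "Suc e"] by (simp add: ival_def add.assoc)

lemma length_ival [simp]: "length (ival i d) = Suc d"
  and set_ival [simp]: "set (ival i d) = {i..i + d}"
  and distinct_ival [simp]: "distinct (ival i d)"
  and ival_not_Nil [simp]: "ival i d \<noteq> []"
  and take_ival: "e \<le> d \<Longrightarrow> take (Suc e) (ival i d) = ival i e"
  by (auto simp: ival_def take_upt simp del: upt_Suc)

lemma ival_hd: obtains w where "ival i d = i # w"
  by (cases d) (auto simp: ival_Cons)

lemma less_append_cong: "length u = length w \<Longrightarrow> u < w \<Longrightarrow> u @ x < w @ y"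
  for u w x y :: "nat list"
  by (induction u w rule: list_induct2) auto

lemma append_less_append [simp]: "u @ x < u @ y \<longleftrightarrow> x < y" for u x y :: "nat list"
  by (induction u) auto

lemma less_append_self: "y \<noteq> [] \<Longrightarrow> u < u @ y" for u y :: "nat list"
  by (induction u) (auto simp: neq_Nil_conv)

lemma lyndon_suffix:
  assumes "lyndon w" "w = u @ v" "u \<noteq> []" "v \<noteq> []"
  shows "w < v"
proof -
  have "length w \<noteq> 1" using assms by (cases u; cases v) auto
  then show ?thesis using assms unfolding lyndon_def by blast
qed

lemma lyndon_ival: "lyndon (ival i d)"
  unfolding lyndon_def
proof (intro conjI disjI2 allI impI)
  fix u v assume uv: "ival i d = u @ v \<and> u \<noteq> [] \<and> v \<noteq> []"
  then have eq: "u @ v = ival i d" by simp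
  have d: "distinct (u @ v)" "set (u @ v) = {i..i + d}"
    unfolding eq by (rule distinct_ival, rule set_ival)
  obtain w where "ival i d = i # w" by (rule ival_hd)
  then obtain u' where u: "u = i # u'" using uv by (cases u) auto
  obtain x v' where v: "v = x # v'" using uv by (cases v) auto
  have "x \<in> {i..i + d}" unfolding d(2)[symmetric] v by simp
  moreover have "x \<noteq> i" using d(1) unfolding u v by auto
  ultimately have "i < x" by auto
  then show "ival i d < v" unfolding eq[symmetric] unfolding u v by simp
qed simp

text \<open>Every prefix of an interval is an interval, so the longest proper Lyndon prefix drops one letter.\<close>

lemma lyndon_split_ival: "lyndon_split (ival i (Suc d)) = Suc d"
proof -
  have t: "take (Suc d) (ival i (Suc d)) = ival i d" by (simp add: take_ival)
  show ?thesis
    unfolding lyndon_split_def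
  proof (rule Max_eqI)
    show "finite {k. 0 < k \<and> k < length (ival i (Suc d)) \<and> lyndon (take k (ival i (Suc d)))}"
      by (rule finite_subset[of _ "{..<length (ival i (Suc d))}"]) auto
    show "Suc d \<in> {k. 0 < k \<and> k < length (ival i (Suc d)) \<and> lyndon (take k (ival i (Suc d)))}"
      using lyndon_ival[of i d] t by simp
  qed auto
qed

lemma falg_expansion: "x = (\<Sum>w\<in>supp x. coef x w \<cdot> word w)"
  by (rule poly_mapping_eqI)
    (auto simp: lookup_sum lookup_single when_def in_keys_iff simp flip: single_conv_smul)

lemma qbracket_word:
  assumes "\<And>u. u \<in> supp x \<Longrightarrow> root_form (weight u) (weight w) = e"
  shows "qbracket q x (word w) = x * word w - (q powi (- e)) \<cdot> (word w * x)"
proof -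
  have "qbracket q x (word w) =
      (\<Sum>u\<in>supp x. coef x u \<cdot> (word u * word w - (q powi (- e)) \<cdot> (word w * word u)))"
    unfolding qbracket_def using assms
    by (intro sum.cong) (auto simp: coef_word smul_def mult.assoc)
  also have "\<dots> = (\<Sum>u\<in>supp x. coef x u \<cdot> word u) * word w
      - (q powi (- e)) \<cdot> (word w * (\<Sum>u\<in>supp x. coef x u \<cdot> word u))"
    by (simp add: sum_distrib_left sum_distrib_right smul_sum smul_simps mult.commute
        flip: sum_subtractf)
  finally show ?thesis by (simp flip: falg_expansion)
qed

text \<open>
  In the recursion for \<open>br\<close>, the first product appends the new letter to every word and so keeps their
  order; the words of the second product begin with the new letter, which exceeds \<open>i\<close>.
\<close>

lemma br_leading:
  obtains R where "br q i d = word (ival i d) + R" "R \<in> FA q {i..i + d}"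
    "\<And>w. w \<in> supp R \<Longrightarrow> mset w = mset (ival i d) \<and> ival i d < w"
proof -
  have "\<exists>R. br q i d = word (ival i d) + R \<and> R \<in> FA q {i..i + d} \<and>
    (\<forall>w\<in>supp R. mset w = mset (ival i d) \<and> ival i d < w)"
  proof (induction d)
    case 0
    then show ?case by (intro exI[of _ 0]) simp
  next
    case (Suc d)
    then obtain R where R: "br q i d = word (ival i d) + R" "R \<in> FA q {i..i + d}"
      "\<And>w. w \<in> supp R \<Longrightarrow> mset w = mset (ival i d) \<and> ival i d < w"
      by blast
    let ?m = "i + Suc d"
    let ?R = "R * word [?m] - q \<cdot> (word [?m] * br q i d)"
    have sub: "x \<in> FA q {i..i + Suc d}" if "x \<in> FA q {i..i + d}" for x
      using that by (force simp: FA_iff)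
    have "br q i (Suc d) = word (ival i (Suc d)) + ?R"
      using R(1) by (simp add: ival_Suc algebra_simps flip: word_mult)
    moreover have "?R \<in> FA q {i..i + Suc d}"
      using sub[OF R(2)] br_FA[of i d "{i..i + Suc d}" q] by auto
    moreover have "mset w = mset (ival i (Suc d)) \<and> ival i (Suc d) < w" if "w \<in> supp ?R" for w
    proof -
      from that consider "w \<in> supp (R * word [?m])" | "w \<in> supp (word [?m] * br q i d)"
        using supp_diff supp_smul by blast
      then show ?thesis
      proof cases
        case 1
        then obtain u where u: "u \<in> supp R" "w = u @ [?m]"
          by (auto elim: supp_multE)
        then show ?thesis
          using R(3)[OF u(1)] less_append_cong[of "ival i d" u "[?m]" "[?m]"]
          by (auto simp: ival_Suc dest: mset_eq_length)
      next
        case 2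
        then obtain u where u: "u \<in> supp (br q i d)" "w = ?m # u"
          by (auto elim: supp_multE)
        from u(1) have "mset u = mset (ival i d)"
          unfolding R(1) using supp_add[of "word (ival i d)" R] R(3) by auto
        moreover obtain t where "ival i d = i # t" by (rule ival_hd)
        ultimately show ?thesis using u(2) by (auto simp: ival_Suc)
      qed
    qed
    ultimately show ?case by blast
  qed
  then show ?thesis using that by blast
qed

lemma coef_weight: "coef (weight w) k = int (count_list w k)"
  by (induction w) (auto simp: weight_def lookup_add simple_root_def lookup_single)

lemma root_form_ival_next:
  assumes "mset u = mset (ival i d)"
  shows "root_form (weight u) (weight [i + Suc d]) = - 1"
proof -
  have "count_list u k = (if k \<in> {i..i + d} then 1 else 0)" for k
  proof -
    have "count_list u k = count (mset (ival i d)) k"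
      using arg_cong[OF assms, of "\<lambda>M. count M k"] by (simp add: count_mset)
    also have "\<dots> = (if k \<in> set (ival i d) then 1 else 0)"
      using distinct_count_atmost_1[THEN iffD1, OF distinct_ival[of i d]] by blast
    finally show ?thesis by (simp only: set_ival)
  qed
  then have c: "coef (weight u) k = (if k \<in> {i..i + d} then 1 else 0)" for k
    by (simp add: coef_weight)
  then have s: "supp (weight u) = {i..i + d}"
    by (auto simp: in_keys_iff split: if_splits)
  have "root_form (weight u) (weight [i + Suc d]) = (\<Sum>k\<in>{i..i + d}. cartan k (i + Suc d))"
  proof -
    have "weight [i + Suc d] = Poly_Mapping.single (i + Suc d) 1"
      by (simp add: weight_def simple_root_def)
    then show ?thesis by (simp add: root_form_def s c)
  qed
  also have "\<dots> = (\<Sum>k\<in>{i..i + d}. if k = i + d then - 1 else 0)"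
    by (rule sum.cong) (auto simp: cartan_def)
  finally show ?thesis by simp
qed

lemma bracketing_ival: "bracketing q (ival i d) = br q i d"
proof (induction d)
  case 0
  then show ?case by (subst bracketing.simps) simp
next
  case (Suc d)
  obtain R where R: "br q i d = word (ival i d) + R"
    "\<And>w. w \<in> supp R \<Longrightarrow> mset w = mset (ival i d) \<and> ival i d < w"
    using br_leading[of q i d] by metis
  have "mset u = mset (ival i d)" if "u \<in> supp (br q i d)" for u
    using that supp_add[of "word (ival i d)" R] R(2) unfolding R(1) by auto
  then have "root_form (weight u) (weight [i + Suc d]) = - 1" if "u \<in> supp (br q i d)" for u
    using that root_form_ival_next by blast
  then have *: "qbracket q (br q i d) (word [i + Suc d]) = br q i (Suc d)"
    by (subst qbracket_word[where e = "- 1"]) auto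
  have t: "take (Suc d) (ival i (Suc d)) = ival i d" "drop (Suc d) (ival i (Suc d)) = [i + Suc d]"
    by (simp_all add: ival_Suc)
  have w: "bracketing q [i + Suc d] = word [i + Suc d]"
    by (subst bracketing.simps) simp
  show ?case
    unfolding bracketing.simps[of q "ival i (Suc d)"] lyndon_split_ival t w Suc.IH *
    by simp
qed

section \<open>Words which are not good\<close>

context iquantum
begin

definition low :: "nat list \<Rightarrow> nat falg \<Rightarrow> bool" where
  "low g x \<longleftrightarrow> x \<in> TT \<and> (\<forall>w\<in>supp x. w \<prec>\<^sub>w g)"

lemma low_closed:
  shows low_add: "low g x \<Longrightarrow> low g y \<Longrightarrow> low g (x + y)"
    and low_diff: "low g x \<Longrightarrow> low g y \<Longrightarrow> low g (x - y)"
    and low_uminus: "low g x \<Longrightarrow> low g (- x)"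
    and low_smul: "c \<in> Qq q \<Longrightarrow> low g x \<Longrightarrow> low g (c \<cdot> x)"
  using supp_add[of x y] supp_diff[of x y] supp_smul[of c x] by (auto simp: low_def)

lemma low_word: "set w \<subseteq> {1..n} \<Longrightarrow> w \<prec>\<^sub>w g \<Longrightarrow> low g (word w)"
  by (auto simp: low_def)

lemma low_mult:
  assumes "x \<in> TT" "y \<in> TT" "\<And>u v. u \<in> supp x \<Longrightarrow> v \<in> supp y \<Longrightarrow> u @ v \<prec>\<^sub>w g"
  shows "low g (x * y)"
  using assms by (auto simp: low_def elim!: supp_multE)

lemma Ui_good_iff:
  "Ui_good q n g \<longleftrightarrow> g \<noteq> [] \<and> set g \<subseteq> {1..n} \<and> \<not> (\<exists>x. low g x \<and> word g \<approx> x)"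
proof (cases "set g \<subseteq> {1..n}")
  case True
  have "Bword q n g = Blin q n x \<longleftrightarrow> word g \<approx> x" if "x \<in> TT" for x
    using True that by (simp add: Bword_eq Blin_eq eqv_iff FA_word)
  then show ?thesis
    unfolding Ui_good_def low_def by blast
qed (simp add: Ui_good_def)

lemma not_good:
  assumes "word g + r \<approx> y" "low g r" "low g y"
  shows "\<not> Ui_good q n g"
proof -
  have "r \<in> TT" using assms(2) by (simp add: low_def)
  then have "word g + r - r \<approx> y - r"
    using assms(1) by (intro T.eqv_diff T.eqv_refl)
  then have "word g \<approx> y - r" by simp
  then show ?thesis using low_diff[OF assms(3,2)] by (auto simp: Ui_good_iff)
qed

text \<open>The order \<open>\<prec>\<close> is compatible with concatenation on both sides.\<close>

lemma good_factor:
  assumes "Ui_good q n (u @ h @ w)" "h \<noteq> []"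
  shows "Ui_good q n h"
proof (rule ccontr)
  assume "\<not> Ui_good q n h"
  have sets: "set u \<subseteq> {1..n}" "set h \<subseteq> {1..n}" "set w \<subseteq> {1..n}"
    using assms(1) by (auto simp: Ui_good_iff)
  then obtain x where x: "low h x" "word h \<approx> x"
    using \<open>\<not> Ui_good q n h\<close> assms(2) by (auto simp: Ui_good_iff)
  have "word u * word h * word w \<approx> word u * x * word w"
    using x sets by (intro T.eqv_mult T.eqv_refl FA_word) auto
  then have "word (u @ h @ w) \<approx> word u * x * word w"
    by (simp add: word_mult)
  moreover have "low (u @ h @ w) (word u * x * word w)"
  proof (rule low_mult)
    fix a c assume "a \<in> supp (word u * x)" "c \<in> supp (word w)"
    then obtain k where k: "k \<in> supp x" "a = u @ k" "c = w"
      by (auto elim: supp_multE)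
    then have "k \<prec>\<^sub>w h" using x by (auto simp: low_def)
    then show "a @ c \<prec>\<^sub>w u @ h @ w"
      using less_append_cong[of h k w w] unfolding k by (auto simp: word_prec_def)
  qed (use x sets in \<open>auto simp: low_def\<close>)
  ultimately show False using assms(1) by (auto simp: Ui_good_iff)
qed

lemma good_no_jump:
  assumes "Ui_good q n [i, j]" shows "j \<le> Suc i"
proof (rule ccontr)
  assume "\<not> j \<le> Suc i"
  moreover have ij: "i \<in> {1..n}" "j \<in> {1..n}" using assms by (auto simp: Ui_good_iff)
  ultimately have "v i * v j \<approx> v j * v i" by (intro v_commute) auto
  then have "word [i, j] \<approx> word [j, i]" by (simp add: word_mult)
  moreover have "low [i, j] (word [j, i])"
    using ij \<open>\<not> j \<le> Suc i\<close> by (intro low_word) (auto simp: word_prec_def)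
  ultimately show False using assms by (auto simp: Ui_good_iff)
qed

end

context iquantum_braid
begin

text \<open>
  For \<open>d = 0\<close> this is the Serre relation. For \<open>d > 0\<close>, a product of the \<open>\<tau>\<close>'s carries the commuting
  pair \<open>v\<^sub>i\<close>, \<open>v\<^sub>i\<^sub>+\<^sub>d\<^sub>+\<^sub>1\<close> to \<open>v\<^sub>i\<^sub>+\<^sub>1\<close> and the bracketing of \<open>i, \<dots>, i + d + 1\<close>. So these commute as well;
  one of the two products has the leading word in question, the other begins with the larger letter
  \<open>i + 1\<close>.
\<close>

lemma not_good_ival_second:
  assumes "1 \<le> i" "i + Suc d \<le> n"
  shows "\<not> Ui_good q n (ival i (Suc d) @ [Suc i])" (is "\<not> Ui_good q n ?g")
proof (cases "d = 0")
  case True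
  let ?j = "Suc i"
  have in_n: "i \<in> {1..n}" "?j \<in> {1..n}" using assms by auto
  have g: "?g = [i, ?j, ?j]" using True by (simp add: ival_Cons)
  have "qserre q (v ?j) (v ?j) (v i) \<approx> - (inverse q \<cdot> v i)"
    by (rule v_serre) (use in_n in auto)
  moreover have "qserre q (v ?j) (v ?j) (v i) =
      word ?g + (word [?j, ?j, i] - (q + inverse q) \<cdot> word [?j, i, ?j])"
    by (simp add: g qserre_def word_mult)
  ultimately show ?thesis
    by (intro not_good[of _ "word [?j, ?j, i] - (q + inverse q) \<cdot> word [?j, i, ?j]" "- (inverse q \<cdot> v i)"])
      (use in_n in \<open>auto simp: g word_prec_def intro!: low_diff low_uminus low_smul low_word\<close>)
next
  case False
  let ?L = "[i..<i + Suc d]" and ?m = "i + Suc d"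
  have L: "set ?L \<subseteq> {1..n}" using assms by auto
  have in_n: "i \<in> {1..n}" "Suc i \<in> {1..n}" "?m \<in> {1..n}" using assms by auto
  have 1: "foldr (sig q) ?L (v i) \<approx> v (Suc i)"
    using foldr_sig_shift_letter[of i i "i + d"] False assms by simp
  have 2: "foldr (sig q) ?L (v ?m) \<approx> br q i (Suc d)"
    unfolding foldr_sig_br using br_TT assms by (intro T.eqv_refl) auto
  have "br q i (Suc d) * v (Suc i) \<approx> foldr (sig q) ?L (v ?m) * foldr (sig q) ?L (v i)"
    by (intro T.eqv_mult T.eqv_sym[OF 1] T.eqv_sym[OF 2])
  also have "\<dots> = foldr (sig q) ?L (v ?m * v i)" by (simp only: foldr_sig_hom)
  also have "\<dots> \<approx> foldr (sig q) ?L (v i * v ?m)"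
    by (intro foldr_sig_eqv L v_commute) (use in_n False in auto)
  also have "\<dots> = foldr (sig q) ?L (v i) * foldr (sig q) ?L (v ?m)" by (simp only: foldr_sig_hom)
  also have "\<dots> \<approx> v (Suc i) * br q i (Suc d)"
    by (intro T.eqv_mult 1 2)
  finally have eq: "br q i (Suc d) * v (Suc i) \<approx> v (Suc i) * br q i (Suc d)" .
  obtain R where R: "br q i (Suc d) = word (ival i (Suc d)) + R" "R \<in> FA q {i..i + Suc d}"
      "\<And>w. w \<in> supp R \<Longrightarrow> mset w = mset (ival i (Suc d)) \<and> ival i (Suc d) < w"
    using br_leading[of q i "Suc d"] by metis
  have RT: "R \<in> TT" using R(2) assms by (force simp: FA_iff)
  have "word ?g + R * v (Suc i) \<approx> v (Suc i) * br q i (Suc d)"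
    using eq unfolding R(1) by (simp add: ring_distribs word_mult)
  moreover have "low ?g (R * v (Suc i))"
  proof (rule low_mult)
    fix u w assume "u \<in> supp R" "w \<in> supp (v (Suc i))"
    then show "u @ w \<prec>\<^sub>w ?g"
      using R(3)[of u] less_append_cong[of "ival i (Suc d)" u]
      by (auto simp: word_prec_def dest!: mset_eq_length)
  qed (use RT in_n in auto)
  moreover have "low ?g (v (Suc i) * br q i (Suc d))"
  proof (rule low_mult)
    fix u w assume u: "u \<in> supp (v (Suc i))" and w: "w \<in> supp (br q i (Suc d))"
    have "mset w = mset (ival i (Suc d))"
      using w supp_add[of "word (ival i (Suc d))" R] R(3) unfolding R(1) by auto
    then have "length w = length (ival i (Suc d))" by (rule mset_eq_length)
    then show "u @ w \<prec>\<^sub>w ?g" using u by (simp add: word_prec_def ival_Cons)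
  qed (use in_n br_TT assms in auto)
  ultimately show ?thesis by (rule not_good)
qed

text \<open>
  A product of the \<open>\<tau>\<close>'s carries the Serre relation of two neighbouring letters to one of
  \<open>z = [i, \<dots>, i + d]\<close> and \<open>v\<^sub>i\<^sub>+\<^sub>d\<^sub>+\<^sub>1\<close>. The leading word of \<open>z z v\<^sub>i\<^sub>+\<^sub>d\<^sub>+\<^sub>1\<close> is the word in
  question, and the other products begin with larger words.
\<close>

lemma not_good_ival_ival:
  assumes "1 \<le> i" "i + Suc d \<le> n"
  shows "\<not> Ui_good q n (ival i d @ ival i (Suc d))" (is "\<not> Ui_good q n ?g")
proof -
  let ?I = "ival i d" and ?m = "i + Suc d"
  let ?L = "[i..<i + d]" and ?z = "br q i d" and ?p = "inverse q"
  have L: "set ?L \<subseteq> {1..n}" using assms by auto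
  have in_n: "i + d \<in> {1..n}" "?m \<in> {1..n}" using assms by auto
  have zT: "?z \<in> TT" using br_TT assms by auto
  have "foldr (sig q) ?L (qserre q (v (i + d)) (v (i + d)) (v ?m)) \<approx> foldr (sig q) ?L (- (?p \<cdot> v ?m))"
    by (intro foldr_sig_eqv L v_serre) (use in_n in auto)
  moreover have "foldr (sig q) ?L (v ?m) = v ?m"
    by (rule foldr_sig_fixed) auto
  ultimately have eq: "qserre q ?z ?z (v ?m) \<approx> - (?p \<cdot> v ?m)"
    by (simp only: foldr_sig_qserre foldr_sig_br foldr_sig_hom)
  obtain R where R: "?z = word ?I + R" "R \<in> FA q {i..i + d}"
      "\<And>w. w \<in> supp R \<Longrightarrow> mset w = mset ?I \<and> ?I < w"
    using br_leading[of q i d] by metis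
  have RT: "R \<in> TT" using R(2) assms by (force simp: FA_iff)
  have IT: "word ?I \<in> TT" using assms by auto
  have len: "length w = Suc d" if "w \<in> supp ?z" for w
    using that supp_add[of "word ?I" R] R(3) mset_eq_length[of w ?I] unfolding R(1) by auto
  have ge: "w = ?I \<or> ?I < w" if "w \<in> supp ?z" for w
    using that supp_add[of "word ?I" R] R(3) unfolding R(1) by auto
  have g: "?g = ?I @ ?I @ [?m]" by (simp add: ival_Suc)
  let ?r1 = "word ?I * (R * v ?m)" and ?r2 = "R * (?z * v ?m)"
  let ?r3 = "(q + ?p) \<cdot> (?z * (v ?m * ?z))" and ?r4 = "v ?m * (?z * ?z)"
  have "qserre q ?z ?z (v ?m) = word ?g + (?r1 + ?r2 - ?r3 + ?r4)"
  proof -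
    have "?z * ?z * v ?m = word ?I * word ?I * v ?m + ?r1 + ?r2"
      using R(1) by (simp add: algebra_simps)
    then show ?thesis by (simp add: qserre_def g word_mult algebra_simps)
  qed
  moreover have "low ?g ?r1"
  proof (rule low_mult)
    fix u w assume u: "u \<in> supp (word ?I)" and "w \<in> supp (R * v ?m)"
    then obtain x where x: "x \<in> supp R" "w = x @ [?m]" by (auto elim: supp_multE)
    then show "u @ w \<prec>\<^sub>w ?g"
      using u R(3)[of x] less_append_cong[of ?I x "[?m]" "[?m]"] unfolding g
      by (auto simp: word_prec_def dest!: mset_eq_length)
  qed (use IT RT in_n in auto)
  moreover have "low ?g ?r2"
  proof (rule low_mult)
    fix u w assume u: "u \<in> supp R" and "w \<in> supp (?z * v ?m)"
    then obtain x where x: "x \<in> supp ?z" "w = x @ [?m]" by (auto elim: supp_multE)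
    then show "u @ w \<prec>\<^sub>w ?g"
      using u R(3)[of u] len[of x] less_append_cong[of ?I u] unfolding g
      by (auto simp: word_prec_def dest!: mset_eq_length)
  qed (use zT RT in_n in auto)
  moreover have "low ?g ?r3"
  proof (intro low_smul low_mult)
    fix u w assume u: "u \<in> supp ?z" and "w \<in> supp (v ?m * ?z)"
    then obtain x where x: "x \<in> supp ?z" "w = ?m # x" by (auto elim: supp_multE)
    have "?I @ ?I @ [?m] < u @ ?m # x"
    proof (cases "u = ?I")
      case True
      obtain t where "ival i d = i # t" by (rule ival_hd)
      then show ?thesis using True by simp
    next
      case False
      then show ?thesis using ge[OF u] len[OF u] by (intro less_append_cong) auto
    qed
    then show "u @ w \<prec>\<^sub>w ?g"
      using len[OF u] len[OF x(1)] x(2) unfolding g by (auto simp: word_prec_def)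
  qed (use zT in_n in auto)
  moreover have "low ?g ?r4"
  proof (rule low_mult)
    fix u w assume u: "u \<in> supp (v ?m)" and "w \<in> supp (?z * ?z)"
    then obtain x y where x: "x \<in> supp ?z" "y \<in> supp ?z" "w = x @ y" by (auto elim: supp_multE)
    moreover obtain t where t: "ival i d = i # t" by (rule ival_hd)
    moreover have "length t = d" using length_ival[of i d] unfolding t by simp
    ultimately show "u @ w \<prec>\<^sub>w ?g"
      using u len[of x] len[of y] unfolding g by (auto simp: word_prec_def)
  qed (use zT in_n in auto)
  moreover have "low ?g (- (?p \<cdot> v ?m))"
    using in_n by (intro low_uminus low_smul low_word) (auto simp: word_prec_def)
  ultimately show ?thesis
    using eq by (intro not_good[of _ "?r1 + ?r2 - ?r3 + ?r4" "- (?p \<cdot> v ?m)"]) (auto intro!: low_add low_diff)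
qed

end

section \<open>Good Lyndon words are intervals\<close>

lemma interval_run:
  "\<exists>d w. i # r = ival i d @ w \<and> (w = [] \<or> hd w \<noteq> Suc (i + d))"
proof (induction r arbitrary: i)
  case Nil
  show ?case by (rule exI[of _ 0]) simp
next
  case (Cons x r)
  show ?case
  proof (cases "x = Suc i")
    case True
    obtain d w where "x # r = ival x d @ w" "w = [] \<or> hd w \<noteq> Suc (x + d)"
      using Cons by blast
    then show ?thesis
      using True by (intro exI[of _ "Suc d"] exI[of _ w]) (simp add: ival_Cons)
  next
    case False
    then show ?thesis by (intro exI[of _ 0] exI[of _ "x # r"]) simp
  qed
qed

text \<open>
  By \<open>A\<close> and \<open>B\<close>, a Lyndon word that begins with the block \<open>i, \<dots>, i + d\<close> but does not continue with
  \<open>i + d + 1\<close> has to restart with \<open>i\<close>. It then repeats the whole block, as a shorter run would give a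
  smaller suffix, and after the repetition \<open>C\<close> forbids the letter \<open>i + d + 1\<close>. So the word is a proper
  power of the block, and its last block is a smaller suffix.
\<close>

lemma lyndon_power_contradiction:
  assumes lyn: "lyndon w"
    and A: "\<And>x y a c. w = x @ [a, c] @ y \<Longrightarrow> c \<le> Suc a"
    and B: "\<And>x y i d. w = x @ (ival i (Suc d) @ [Suc i]) @ y \<Longrightarrow> False"
    and C: "\<And>x y i d. w = x @ (ival i d @ ival i (Suc d)) @ y \<Longrightarrow> False"
    and w: "w = concat (replicate t (ival i d)) @ r" "t \<ge> 1"
    and t: "t = 1 \<Longrightarrow> r \<noteq> [] \<and> hd r \<noteq> Suc (i + d)"
  shows False
  using w t
proof (induction "length r" arbitrary: r t rule: less_induct)
  case less
  let ?I = "ival i d"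
  obtain s where s: "t = Suc s" using less.prems(2) by (cases t) auto
  have pw: "concat (replicate t ?I) = concat (replicate s ?I) @ ?I"
    unfolding s by (induction s) auto
  have pw': "concat (replicate t ?I) = ?I @ concat (replicate s ?I)"
    unfolding s by simp
  obtain I' where I': "?I = i # I'" by (rule ival_hd)
  obtain w' where w': "w = i # w'" using less.prems(1) unfolding pw' unfolding I' by auto
  show False
  proof (cases r)
    case Nil
    then have "s \<noteq> 0" using less.prems(3) s by auto
    then have ne: "concat (replicate s ?I) \<noteq> []" by (cases s) auto
    have "w < ?I"
      by (rule lyndon_suffix[OF lyn _ ne]) (use less.prems(1) Nil pw in auto)
    moreover have "?I < w"
      using less_append_self[OF ne, of ?I] less.prems(1) Nil pw' by simp
    ultimately show False by simp
  next
    case (Cons c r')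
    have rw: "w < r"
      using less.prems(1,2) Cons I' s by (intro lyndon_suffix[OF lyn]) auto
    then have "i \<le> c" using w' Cons by auto
    have split: "w = (concat (replicate s ?I)) @ ?I @ r"
      using less.prems(1) unfolding pw by simp
    obtain J where J: "?I = J @ [i + d]"
      by (cases d) (auto simp: ival_Suc)
    have "c \<le> Suc (i + d)"
      by (rule A[of "concat (replicate s ?I) @ J" "i + d" c r']) (simp add: split J Cons)
    then consider "c = Suc (i + d)" | "i < c" "c \<le> i + d" | "c = i"
      using \<open>i \<le> c\<close> by linarith
    then show False
    proof cases
      case 1
      then have "s \<noteq> 0" using less.prems(3) s Cons by auto
      then obtain s' where s': "s = Suc s'" by (cases s) auto
      have "concat (replicate s ?I) = concat (replicate s' ?I) @ ?I"
        unfolding s' by (induction s') auto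
      then have "w = concat (replicate s' ?I) @ (ival i d @ ival i (Suc d)) @ r'"
        using split Cons 1 by (simp add: ival_Suc)
      then show False by (rule C)
    next
      case 2
      define e where "e = i + d - c"
      define k where "k = c - 1"
      have ke: "c = Suc k" "d = (k - i) + Suc e" "i \<le> k" "i + d = k + Suc e"
        using 2 by (auto simp: e_def k_def)
      have "\<exists>x. ?I = x @ ival k (Suc e)"
      proof (cases "k = i")
        case True
        then have "d = Suc e" using ke by simp
        then show ?thesis using True by simp
      next
        case False
        then obtain f where f: "k = i + Suc f"
          using ke(3) less_imp_Suc_add[of i k] by (auto simp: order_less_le)
        then have "d = f + Suc (Suc e)" using ke by simp
        then show ?thesis using ival_append[of i f "Suc e"] f by simp
      qed
      then obtain x where x: "?I = x @ ival k (Suc e)" by blast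
      have "w = (concat (replicate s ?I) @ x) @ (ival k (Suc e) @ [Suc k]) @ r'"
        using split unfolding Cons ke(1) x by simp
      then show False by (rule B)
    next
      case 3
      obtain e z where ez: "r = ival i e @ z" "z = [] \<or> hd z \<noteq> Suc (i + e)"
        using interval_run[of i r'] unfolding Cons 3 by blast
      show False
      proof (cases "d \<le> e")
        case True
        have "\<exists>y. ival i e = ?I @ y"
        proof (cases "e = d")
          case False
          then obtain f where "e = d + Suc f"
            using True less_imp_Suc_add[of d e] by auto
          then show ?thesis using ival_append[of i d f] by simp
        qed simp
        then obtain y where y: "ival i e = ?I @ y" by blast
        have rr: "r = ?I @ (y @ z)" using ez(1) y by simp
        have "length (y @ z) < length r"
          unfolding rr length_append[of ?I] using I' by simp
        moreover have "w = concat (replicate (Suc t) ?I) @ (y @ z)"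
        proof -
          have "concat (replicate (Suc t) ?I) = concat (replicate t ?I) @ ?I"
            by (induction t) auto
          then show ?thesis using less.prems(1) rr by simp
        qed
        ultimately show False
          using less.hyps[of "y @ z" "Suc t"] less.prems(2) by simp
      next
        case False
        then obtain f where f: "d = e + Suc f"
          using less_imp_Suc_add[of e d] by auto
        obtain y where y: "?I = ival i e @ Suc (i + e) # y"
          using ival_append[of i e f] ival_hd[of "i + Suc e" f] unfolding f by (metis add_Suc_right)
        have "w = ?I @ concat (replicate s ?I) @ r"
          using less.prems(1) pw' by simp
        then have wy: "w = ival i e @ Suc (i + e) # (y @ concat (replicate s ?I) @ r)"
          using y by simp
        have "r < w"
        proof (cases z)
          case Nil
          then show ?thesis
            using ez(1) less_append_self[of "Suc (i + e) # (y @ concat (replicate s ?I) @ r)" "ival i e"]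
            unfolding wy by simp
        next
          case (Cons x z')
          obtain J' where J': "ival i e = J' @ [i + e]"
            by (cases e) (auto simp: ival_Suc)
          have "x \<le> Suc (i + e)"
            by (rule A[of "concat (replicate t ?I) @ J'" "i + e" x z'])
              (simp add: less.prems(1) ez(1) J' Cons)
          then have "x < Suc (i + e)" using ez(2) Cons by simp
          then show ?thesis
            unfolding wy using ez(1) Cons by simp
        qed
        with rw show False by simp
      qed
    qed
  qed
qed

context iquantum_braid
begin

text \<open>Factors of good words are good, so the three kinds of words which are not good cannot occur.\<close>

lemma good_lyndon_imp_ival:
  assumes "lyndon w" "Ui_good q n w"
  obtains i d where "1 \<le> i" "i + d \<le> n" "w = ival i d"
proof -
  have w: "w \<noteq> []" "set w \<subseteq> {1..n}" using assms(2) by (auto simp: Ui_good_iff)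
  have A: "c \<le> Suc a" if "w = x @ [a, c] @ y" for x y a c
    using assms(2) good_factor[of x "[a, c]" y] good_no_jump unfolding that by blast
  have bounds: "1 \<le> i \<and> i + d \<le> n" if "w = x @ ival i d @ y" for x y i d
    using w(2) unfolding that by auto
  have B: False if "w = x @ (ival i (Suc d) @ [Suc i]) @ y" for x y i d
    using assms(2) good_factor[of x "ival i (Suc d) @ [Suc i]" y] not_good_ival_second[of i d]
      bounds[of x i "Suc d" "[Suc i] @ y"] unfolding that by auto
  have C: False if "w = x @ (ival i d @ ival i (Suc d)) @ y" for x y i d
    using assms(2) good_factor[of x "ival i d @ ival i (Suc d)" y] not_good_ival_ival[of i d]
      bounds[of "x @ ival i d" i "Suc d" y] unfolding that by auto
  obtain i r where "w = i # r" using w by (cases w) auto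
  then obtain d z where dz: "w = ival i d @ z" "z = [] \<or> hd z \<noteq> Suc (i + d)"
    using interval_run[of i r] by blast
  have "z = []"
  proof (rule ccontr)
    assume "z \<noteq> []"
    show False
    proof (rule lyndon_power_contradiction[OF assms(1), where t = 1 and i = i and d = d and r = z])
      show "c \<le> Suc a" if "w = x @ [a, c] @ y" for x y a c using that by (rule A)
      show False if "w = x @ (ival i (Suc d) @ [Suc i]) @ y" for x y i d using that by (rule B)
      show False if "w = x @ (ival i d @ ival i (Suc d)) @ y" for x y i d using that by (rule C)
      show "w = concat (replicate 1 (ival i d)) @ z"
        unfolding One_nat_def replicate_Suc replicate_0 using dz(1) by simp
      show "z \<noteq> [] \<and> hd z \<noteq> Suc (i + d)" using dz(2) \<open>z \<noteq> []\<close> by blast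
    qed (rule order_refl)
  qed
  then have "w = ival i d" using dz(1) by simp
  moreover from this have "1 \<le> i \<and> i + d \<le> n" using bounds[of "[]" i d "[]"] by simp
  ultimately show ?thesis by (intro that) auto
qed

end

section \<open>Intervals are good\<close>

text \<open>
  The vector representation of the quantum group. It is extended to the functions on all of \<open>\<nat>\<close>, so
  that the action of a generator does not depend on \<open>n\<close>.
\<close>

primrec gact :: "complex \<Rightarrow> qgen \<Rightarrow> (nat \<Rightarrow> complex) \<Rightarrow> nat \<Rightarrow> complex" where
  "gact q (GE i) f = (\<lambda>k. if k = i then f (Suc i) else 0)"
| "gact q (GF i) f = (\<lambda>k. if k = Suc i then f i else 0)"
| "gact q (GK i) f = (\<lambda>k. (if k = i then q else if k = Suc i then inverse q else 1) * f k)"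
| "gact q (GKinv i) f = (\<lambda>k. (if k = i then inverse q else if k = Suc i then q else 1) * f k)"

definition act :: "complex \<Rightarrow> qgen falg \<Rightarrow> (nat \<Rightarrow> complex) \<Rightarrow> nat \<Rightarrow> complex" where
  "act q x f = (\<lambda>k. \<Sum>w\<in>supp x. coef x w * foldr (gact q) w f k)"

lemma foldr_gact_linear:
  "foldr (gact q) w (\<lambda>k. f k + g k) = (\<lambda>k. foldr (gact q) w f k + foldr (gact q) w g k)"
  "foldr (gact q) w (\<lambda>k. c * f k) = (\<lambda>k. c * foldr (gact q) w f k)"
  "foldr (gact q) w (\<lambda>k. 0) = (\<lambda>k. 0)"
proof -
  have 1: "gact q g (\<lambda>k. f k + h k) = (\<lambda>k. gact q g f k + gact q g h k)" for g f h
    by (cases g) (auto simp: algebra_simps)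
  show "foldr (gact q) w (\<lambda>k. f k + g k) = (\<lambda>k. foldr (gact q) w f k + foldr (gact q) w g k)"
    by (induction w) (simp_all add: 1)
  have 2: "gact q g (\<lambda>k. c * f k) = (\<lambda>k. c * gact q g f k)" for g f c
    by (cases g) (auto simp: algebra_simps)
  show sc: "foldr (gact q) w (\<lambda>k. c * f k) = (\<lambda>k. c * foldr (gact q) w f k)" for c f
    by (induction w) (simp_all add: 2)
  show "foldr (gact q) w (\<lambda>k. 0) = (\<lambda>k. 0)"
    using sc[of 0 "\<lambda>k. 0"] by simp
qed

lemma act_single: "act q (Poly_Mapping.single w c) f = (\<lambda>k. c * foldr (gact q) w f k)"
  by (simp add: act_def)

lemma act_0 [simp]: "act q 0 f = (\<lambda>k. 0)"
  by (simp add: act_def)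

lemma act_add: "act q (x + y) f = (\<lambda>k. act q x f k + act q y f k)"
  unfolding act_def
  by (rule ext, rule setsum_keys_plus_distrib[where f = "\<lambda>w c. c * foldr (gact q) w f _"])
    (simp_all add: algebra_simps)

lemma act_mult: "act q (x * y) f = act q x (act q y f)"
proof (induction x rule: falg_induct)
  case (single u c)
  show ?case
    by (induction y rule: falg_induct)
      (simp_all add: single_mult_single act_single act_add foldr_gact_linear ring_distribs mult.assoc)
qed (simp_all add: act_add ring_distribs)

lemma act_zero_vector: "act q x (\<lambda>k. 0) = (\<lambda>k. 0)"
  by (simp add: act_def foldr_gact_linear)

lemma act_word: "act q (word w) f = foldr (gact q) w f"
  by (simp add: word_def act_single)

lemma act_scal: "act q (scal c) f = (\<lambda>k. c * f k)"
  by (simp add: scal_def act_single)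

lemma act_1: "act q 1 f = f"
  using act_scal[of q 1 f] by simp

lemma act_uminus: "act q (- x) f = (\<lambda>k. - act q x f k)"
proof
  fix k show "act q (- x) f k = - act q x f k"
    using fun_cong[OF act_add[of q x "- x" f], of k] by (simp add: eq_neg_iff_add_eq_0 add.commute)
qed

lemma act_diff: "act q (x - y) f = (\<lambda>k. act q x f k - act q y f k)"
  using act_add[of q x "- y" f] by (simp add: act_uminus)

lemmas act_simps = act_add act_diff act_mult act_word act_scal act_1 smul_def

lemma act_ideal: "ideal {x \<in> FA q S. \<forall>f. act q x f = (\<lambda>k. 0)} (free_algebra (Qq q) S)"
  (is "ideal ?N ?R")
proof (rule idealI)
  interpret R: ring ?R by (rule ring_free_algebra)
  show "ring ?R" by (rule ring_free_algebra)
  show "subgroup ?N (add_monoid ?R)"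
  proof (rule R.add.subgroupI)
    show "\<ominus>\<^bsub>?R\<^esub> x \<in> ?N" if "x \<in> ?N" for x
      using that by (simp add: free_algebra_a_inv act_uminus)
  qed (auto simp: act_add)
qed (auto simp: act_mult act_zero_vector)

lemma cartan_adjacent_iff: "i \<noteq> j \<Longrightarrow> cartan i j = - 1 \<longleftrightarrow> i = Suc j \<or> j = Suc i"
  by (auto simp: cartan_def)

context iquantum
begin

lemma relators_act:
  assumes "r \<in> Uq_relators q n" shows "act q r f = (\<lambda>k. 0)"
proof -
  have q1: "q - inverse q \<noteq> 0"
    using q_nz q_sq by (simp add: field_simps power2_eq_square)
  have K: "act q (KK i * KKinv i - 1) f = (\<lambda>k. 0)" "act q (KKinv i * KK i - 1) f = (\<lambda>k. 0)" for i
    using q_nz by (auto simp: act_simps fun_eq_iff)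
  have KK: "act q (KK i * KK j - KK j * KK i) f = (\<lambda>k. 0)" for i j
    by (simp add: act_simps fun_eq_iff)
  have KE: "act q (KK i * EE j * KKinv i - scal (q powi cartan i j) * EE j) f = (\<lambda>k. 0)" for i j
    using q_nz by (auto simp: act_simps fun_eq_iff cartan_def power_int_minus power2_eq_square)
  have KF: "act q (KK i * FF j * KKinv i - scal (q powi (- cartan i j)) * FF j) f = (\<lambda>k. 0)" for i j
    using q_nz by (auto simp: act_simps fun_eq_iff cartan_def power_int_minus power2_eq_square)
  have EF: "act q (EE i * FF j - FF j * EE i
           - (if i = j then scal (1 / (q - inverse q)) * (KK i - KKinv i) else 0)) f = (\<lambda>k. 0)" for i j
  proof -
    define c where "c = 1 / (q - inverse q)"
    have c: "c * (q * y - inverse q * y) = y" for y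
    proof -
      have "c * (q * y - inverse q * y) = (c * (q - inverse q)) * y" by (simp add: algebra_simps)
      also have "c * (q - inverse q) = 1" using q1 by (simp add: c_def)
      finally show ?thesis by simp
    qed
    have c': "c * (inverse q * y - q * y) = - y" for y
      using c[of "- y"] by simp
    have "act q (EE i * FF i - FF i * EE i - scal c * (KK i - KKinv i)) f k = 0" for k
      unfolding act_diff act_mult act_word act_scal
      by (cases "k = i"; cases "k = Suc i") (simp_all add: c c')
    moreover have "act q (EE i * FF j - FF j * EE i) f k = 0" if "i \<noteq> j" for k
      unfolding act_diff act_mult act_word using that by auto
    ultimately show ?thesis by (auto simp: fun_eq_iff c_def)
  qed
  have SE: "act q (serre_relator q EE i j) f = (\<lambda>k. 0)" if "i \<noteq> j" for i j
    using that by (auto simp: serre_relator_eq cartan_adjacent_iff qserre_def act_simps fun_eq_iff)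
  have SF: "act q (serre_relator q FF i j) f = (\<lambda>k. 0)" if "i \<noteq> j" for i j
    using that by (auto simp: serre_relator_eq cartan_adjacent_iff qserre_def act_simps fun_eq_iff)
  show ?thesis
    using assms unfolding Uq_relators_def by (auto simp only: UN_iff Un_iff insert_iff empty_iff Diff_iff
        K KK KE KF EF SE SF)
qed

lemma Uq_ideal_act: "x \<in> Uq_ideal q n \<Longrightarrow> act q x f = (\<lambda>k. 0)"
proof -
  interpret R: ring "Uq_free q n" by (rule ring_free_algebra)
  have "Uq_relators q n \<subseteq> {x \<in> FA q (qgens n). \<forall>f. act q x f = (\<lambda>k. 0)}"
    using relators_FA relators_act by blast
  then show "x \<in> Uq_ideal q n \<Longrightarrow> act q x f = (\<lambda>k. 0)"
    unfolding Uq_ideal_def using R.genideal_minimal[OF act_ideal] by blast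
qed

text \<open>
  The action of \<open>B\<^sub>i\<close>; the coefficient of the second part is \<open>- q\<^sup>-\<^sup>2\<close> times the eigenvalue \<open>q\<close> of
  \<open>K\<^sub>i\<inverse>\<close>.
\<close>

definition bact :: "nat \<Rightarrow> (nat \<Rightarrow> complex) \<Rightarrow> nat \<Rightarrow> complex" where
  "bact i f k = (if k = Suc i then f i else if k = i then - inverse q * f (Suc i) else 0)"

lemma bact_nz: "bact i f k \<noteq> 0 \<Longrightarrow> k = Suc i \<and> f i \<noteq> 0 \<or> k = i \<and> f (Suc i) \<noteq> 0"
  by (auto simp: bact_def split: if_splits)

lemma bact_self: "bact k f k = - inverse q * f (Suc k)"
  by (simp add: bact_def)

lemma act_b: "act q (b i) f = bact i f"
  using q_nz by (auto simp: act_simps fun_eq_iff bact_def power_int_minus power2_eq_square)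

lemma act_subst: "act q (subst b x) f k = (\<Sum>w\<in>supp x. coef x w * foldr bact w f k)"
proof -
  have "act q (prod_list (map b w)) f = foldr bact w f" for w f
    by (induction w) (simp_all add: act_mult act_b act_1)
  then have s: "act q (subst b (Poly_Mapping.single w c)) f k = c * foldr bact w f k" for w c
    by (simp add: subst_single smul_def act_mult act_scal)
  show ?thesis
  proof (induction x rule: falg_induct)
    case (add x y)
    then show ?case
      unfolding subst_add act_add
      by (subst setsum_keys_plus_distrib[where f = "\<lambda>w c. c * foldr bact w f k"])
        (simp_all add: algebra_simps)
  qed (simp_all add: s)
qed

text \<open>
  Each \<open>B\<^sub>i\<close> moves a basis vector by one step, so the word \<open>k, \<dots>, m - 1\<close> is the only one of length
  at most \<open>m - k\<close> with a nonzero matrix coefficient from the \<open>m\<close>-th to the \<open>k\<close>-th basis vector.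
\<close>

lemma bact_path_unique:
  assumes "foldr bact w (\<lambda>j. if j = m then 1 else 0) k \<noteq> 0" "length w + k \<le> m"
  shows "w = [k..<m]"
  using assms
proof (induction w arbitrary: k)
  case Nil
  then show ?case by (simp split: if_splits)
next
  case (Cons i w)
  have "bact i (foldr bact w (\<lambda>j. if j = m then 1 else 0)) k \<noteq> 0"
    using Cons.prems(1) by simp
  then consider "k = Suc i" "foldr bact w (\<lambda>j. if j = m then 1 else 0) i \<noteq> 0"
    | "k = i" "foldr bact w (\<lambda>j. if j = m then 1 else 0) (Suc i) \<noteq> 0"
    using bact_nz by blast
  then show ?case
  proof cases
    case 1
    then have "w = [i..<m]" using Cons by simp
    then show ?thesis using Cons.prems(2) 1 by simp
  next
    case 2
    then have "w = [Suc i..<m]" using Cons by simp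
    then show ?thesis using Cons.prems(2) 2 by (simp add: upt_conv_Cons)
  qed
qed

lemma bact_path: "foldr bact [k..<k + e] (\<lambda>j. if j = k + e then 1 else 0) k \<noteq> 0"
proof (induction e arbitrary: k)
  case (Suc e)
  have "[k..<k + Suc e] = k # [Suc k..<Suc k + e]" by (simp add: upt_conv_Cons del: upt_Suc)
  then show ?case using Suc[of "Suc k"] q_nz by (simp add: bact_self del: upt_Suc)
qed simp

lemma ival_good:
  assumes "1 \<le> i" "i + d \<le> n" shows "Ui_good q n (ival i d)"
proof -
  have False if x: "low (ival i d) x" "word (ival i d) \<approx> x" for x
  proof -
    let ?m = "i + Suc d"
    let ?e = "\<lambda>j. if j = ?m then 1 else 0 :: complex"
    have I: "word (ival i d) \<in> TT" using assms by (intro FA_word) auto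
    have xT: "x \<in> TT" using x(1) by (simp add: low_def)
    have iv: "ival i d = [i..<?m]" by (simp add: ival_def)
    have "subst b (word (ival i d)) - subst b x \<in> Uq_ideal q n"
      using x(2) Phi_eq_iff[OF I xT] by (simp only: eqv_iff)
    then have "act q (subst b (word (ival i d))) ?e i = act q (subst b x) ?e i"
      using fun_cong[OF Uq_ideal_act[of "subst b (word (ival i d)) - subst b x" ?e], of i]
      by (simp only: act_diff) simp
    also have "act q (subst b (word (ival i d))) ?e i = foldr bact (ival i d) ?e i"
      unfolding act_subst by (simp add: coef_word)
    also have "act q (subst b x) ?e i = 0"
      unfolding act_subst
    proof (rule sum.neutral, rule ballI)
      fix w assume "w \<in> supp x"
      then have "w \<prec>\<^sub>w ival i d" using x(1) by (simp add: low_def)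
      then have "w \<noteq> [i..<?m]" "length w + i \<le> ?m"
        unfolding iv[symmetric] by (auto simp: word_prec_def)
      then have "foldr bact w ?e i = 0" using bact_path_unique[of w ?m i] by blast
      then show "coef x w * foldr bact w ?e i = 0" by simp
    qed
    finally show False using bact_path[of i "Suc d"] unfolding iv by blast
  qed
  then show ?thesis using assms unfolding Ui_good_iff by auto
qed

end

context iquantum_braid
begin

lemma good_lyndon_eq: "good_lyndon q n = (\<lambda>(i, d). ival i d) ` set (intervals n)"
proof -
  have "w \<in> (\<lambda>(i, d). ival i d) ` set (intervals n)" if "w \<in> good_lyndon q n" for w
  proof -
    have "lyndon w" "Ui_good q n w" using that by (simp_all add: good_lyndon_def)
    then obtain i d where "1 \<le> i" "i + d \<le> n" "w = ival i d" by (rule good_lyndon_imp_ival)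
    then show ?thesis by (auto simp: set_intervals)
  qed
  moreover have "ival i d \<in> good_lyndon q n" if "(i, d) \<in> set (intervals n)" for i d
    using that ival_good lyndon_ival by (simp add: good_lyndon_def set_intervals)
  ultimately show ?thesis by auto
qed

end

section \<open>Ordered products\<close>

lemma ival_less: "i < j \<or> i = j \<and> d < e \<Longrightarrow> ival i d < ival j e"
proof (elim disjE conjE)
  assume "i < j"
  moreover obtain w w' where "ival i d = i # w" "ival j e = j # w'" by (metis ival_hd)
  ultimately show ?thesis by simp
next
  assume "i = j" "d < e"
  then obtain f where "e = d + Suc f" using less_imp_Suc_add by auto
  then show ?thesis using \<open>i = j\<close> ival_append[of i d f] less_append_self by simp
qed

lemma sorted_intervals: "sorted_wrt (<) (map (\<lambda>(i, d). ival i d) (intervals m))"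
proof -
  have "sorted_wrt (\<lambda>x y. fst x < fst y \<or> fst x = fst y \<and> snd x < snd y) (intervals m)"
  proof (induction m)
    case 0
    then show ?case by (simp add: intervals_def)
  next
    case (Suc m)
    have "sorted_wrt (\<lambda>x y. fst x < fst y \<or> fst x = fst y \<and> snd x < snd y) (map (Pair (1::nat)) [0..<Suc m])"
      by (simp add: sorted_wrt_map del: upt_Suc)
    then show ?case
      using Suc unfolding intervals_Suc sorted_wrt_append
      by (auto simp: sorted_wrt_map case_prod_beta set_intervals simp del: upt_Suc)
  qed
  then show ?thesis
    unfolding sorted_wrt_map
    by (rule sorted_wrt_mono_rel[rotated]) (auto intro!: ival_less)
qed

lemma sorted_blocks:
  fixes g :: "'a \<Rightarrow> 'b :: linorder"
  shows "sorted (map g js) \<Longrightarrow> sorted (concat (map (\<lambda>j. replicate (a j) (g j)) js))"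
  by (induction js) (auto simp: sorted_append)

lemma prod_list_blocks:
  "prod_list (map f (concat (map (\<lambda>j. replicate (a j) (g j)) js))) = prod_list (map (\<lambda>j. f (g j) ^ a j) js)"
  for f :: "'b \<Rightarrow> 'c :: monoid_mult"
  by (induction js) (simp_all add: prod_list_replicate)

lemma rev_blocks:
  "rev (concat (map (\<lambda>j. replicate (a j) (g j)) js)) = concat (map (\<lambda>j. replicate (a j) (g j)) (rev js))"
  by (induction js) simp_all

text \<open>Both sides are sorted and have the same multiplicities.\<close>

lemma sorted_list_blocks:
  fixes g :: "'a \<Rightarrow> 'b :: linorder"
  assumes g: "sorted_wrt (<) (map g js)" and ls: "sorted ls" "set ls \<subseteq> set (map g js)"
  shows "ls = concat (map (\<lambda>j. replicate (count_list ls (g j)) (g j)) js)"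
proof -
  let ?rhs = "concat (map (\<lambda>j. replicate (count_list ls (g j)) (g j)) js)"
  have d: "distinct (map g js)" and s: "sorted (map g js)"
    using g by (simp_all add: strict_sorted_iff)
  have "count (mset (concat (map (\<lambda>j. replicate (c (g j)) (g j)) js))) y =
      (if y \<in> set (map g js) then c y else 0)" if "distinct (map g js)" for c y
    using that by (induction js) auto
  from this[OF d, of "count_list ls"] have "mset ?rhs = mset ls"
    using ls(2) by (intro multiset_eqI) (auto simp: count_mset count_list_0_iff)
  then have "sort ls = ?rhs"
    by (rule properties_for_sort[OF _ sorted_blocks[OF s]])
  then show ?thesis using ls(1) by (simp add: sorted_sort_id)
qed

context iquantum_braid
begin

text \<open>The \<open>j\<close>-th Lyndon word, counted from one as the roots are.\<close>

definition word_nr :: "nat \<Rightarrow> nat list" where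
  "word_nr j = map (\<lambda>(i, d). ival i d) (intervals n) ! (j - 1)"

abbreviation "indices \<equiv> [1..<Suc (num_pos_roots n)]"

lemma map_word_nr: "map word_nr indices = map (\<lambda>(i, d). ival i d) (intervals n)"
  by (rule nth_equalityI) (simp_all add: length_intervals word_nr_def del: upt_Suc)

lemma set_word_nr: "word_nr ` set indices = good_lyndon q n"
proof -
  have "word_nr ` set indices = set (map word_nr indices)" by (simp only: set_map)
  also have "\<dots> = good_lyndon q n" unfolding map_word_nr good_lyndon_eq by (simp only: set_map)
  finally show ?thesis .
qed

lemma bracketing_word_nr:
  assumes "j \<in> set indices"
  shows "bracketing q (word_nr j) \<in> TT"
    and "root_vector q n \<tau> j = Phi (bracketing q (word_nr j))"
proof -
  have j: "1 \<le> j" "j \<le> num_pos_roots n" using assms by (auto simp del: upt_Suc)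
  obtain i d where id: "intervals n ! (j - 1) = (i, d)" by (cases "intervals n ! (j - 1)")
  have less: "j - 1 < length (intervals n)" using j by (simp add: length_intervals)
  then have b: "bracketing q (word_nr j) = br q i d"
    by (simp add: word_nr_def id bracketing_ival)
  have "(i, d) \<in> set (intervals n)" using nth_mem[OF less] id by simp
  then show "bracketing q (word_nr j) \<in> TT" unfolding b by (simp add: set_intervals br_TT)
  show "root_vector q n \<tau> j = Phi (bracketing q (word_nr j))"
    unfolding b by (rule root_vector_eq[OF j id])
qed

lemma Blin_blocks:
  assumes "set js \<subseteq> set indices"
  shows "Blin q n (prod_list (map (bracketing q) (concat (map (\<lambda>j. replicate (a j) (word_nr j)) js)))) =
    ordered_prod (Ui q n) (map (\<lambda>j. root_vector q n \<tau> j [^]\<^bsub>Ui q n\<^esub> (a j)) js)"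
proof -
  let ?ps = "map (\<lambda>j. bracketing q (word_nr j) ^ a j) js"
  have ps: "set ?ps \<subseteq> TT" using assms bracketing_word_nr(1) by (auto simp del: upt_Suc)
  have "map (\<lambda>j. root_vector q n \<tau> j [^]\<^bsub>Ui q n\<^esub> (a j)) js = map Phi ?ps"
    using assms bracketing_word_nr Phi_power by (auto simp del: upt_Suc)
  then show ?thesis
    unfolding prod_list_blocks using ordered_prod_Phi[OF ps] Blin_eq[OF FA_prod_list[OF ps]]
    by (simp only:)
qed

lemma sorted_good_lyndon_lists:
  "{ls. set ls \<subseteq> good_lyndon q n \<and> sorted ls} =
     range (\<lambda>a. concat (map (\<lambda>j. replicate (a j) (word_nr j)) indices))"
proof (intro equalityI subsetI)
  have strict: "sorted_wrt (<) (map word_nr indices)"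
    unfolding map_word_nr by (rule sorted_intervals)
  fix ls
  {
    assume "ls \<in> {ls. set ls \<subseteq> good_lyndon q n \<and> sorted ls}"
    then have "ls = concat (map (\<lambda>j. replicate (count_list ls (word_nr j)) (word_nr j)) indices)"
      by (intro sorted_list_blocks[OF strict]) (simp_all only: set_map set_word_nr mem_Collect_eq)
    then show "ls \<in> range (\<lambda>a. concat (map (\<lambda>j. replicate (a j) (word_nr j)) indices))"
      by (rule image_eqI[where x = "\<lambda>j. count_list ls (word_nr j)"]) simp
  next
    assume "ls \<in> range (\<lambda>a. concat (map (\<lambda>j. replicate (a j) (word_nr j)) indices))"
    then obtain a where a: "ls = concat (map (\<lambda>j. replicate (a j) (word_nr j)) indices)" by blast
    have "sorted ls"
      unfolding a using strict by (intro sorted_blocks) (simp add: strict_sorted_iff del: upt_Suc)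
    moreover have "set ls \<subseteq> word_nr ` set indices"
      unfolding a by (auto simp del: upt_Suc split: if_splits)
    ultimately show "ls \<in> {ls. set ls \<subseteq> good_lyndon q n \<and> sorted ls}"
      unfolding set_word_nr by simp
  }
qed

lemma bases_coincide:
  "lyndon_basis_opp q n = pbw_basis q n \<tau>" "lyndon_basis q n = pbw_basis_opp q n \<tau>"
proof -
  let ?f = "\<lambda>ls. Blin q n (prod_list (map (bracketing q) ls))"
  let ?blocks = "\<lambda>a. concat (map (\<lambda>j. replicate (a j) (word_nr j)) indices)"
  have "lyndon_basis_opp q n = ?f ` {ls. set ls \<subseteq> good_lyndon q n \<and> sorted ls}"
    unfolding lyndon_basis_opp_def by blast
  also have "\<dots> = range (\<lambda>a. ?f (?blocks a))"
    unfolding sorted_good_lyndon_lists image_image ..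
  also have "\<dots> = pbw_basis q n \<tau>"
    unfolding Blin_blocks[OF order_refl] pbw_basis_def by blast
  finally show "lyndon_basis_opp q n = pbw_basis q n \<tau>" .
  have "lyndon_basis q n = ?f ` rev ` {ls. set ls \<subseteq> good_lyndon q n \<and> sorted ls}"
  proof -
    have "{ls. set ls \<subseteq> good_lyndon q n \<and> sorted_wrt (\<ge>) ls} =
        rev ` {ls. set ls \<subseteq> good_lyndon q n \<and> sorted ls}"
      by (auto simp: sorted_wrt_rev intro!: image_eqI[where x = "rev _"])
    then show ?thesis unfolding lyndon_basis_def by blast
  qed
  also have "\<dots> = range (\<lambda>a. ?f (rev (?blocks a)))"
    unfolding sorted_good_lyndon_lists image_image ..
  also have "\<dots> = pbw_basis_opp q n \<tau>"
  proof -
    have "set (rev indices) \<subseteq> set indices" by (simp only: set_rev order_refl)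
    then show ?thesis
      unfolding rev_blocks pbw_basis_opp_def by (subst Blin_blocks) blast+
  qed
  finally show "lyndon_basis q n = pbw_basis_opp q n \<tau>" .
qed

end

theorem corollary4p3p2:
  fixes q :: complex and n :: nat
    and \<tau> :: "nat \<Rightarrow> qgen falg set \<Rightarrow> qgen falg set"
  assumes "n \<ge> 1"
    and "q \<noteq> 0"
    and "\<forall>k::nat. k > 0 \<longrightarrow> q ^ k \<noteq> 1"
    and "braid_automorphisms q n \<tau>"
  shows "lyndon_basis q n = pbw_basis_opp q n \<tau> \<and> lyndon_basis_opp q n = pbw_basis q n \<tau>"
proof -
  interpret iquantum_braid q n \<tau>
    by unfold_locales (use assms in auto)
  show ?thesis using bases_coincide by simp
qed

end
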